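(* Let $F$ and $G$ be two regular control systems (regular in domains $D_F,D_G\subset\mathbb{R}^3$ respectively). Then $F$ and $G$ are locally feedback equivalent if and only if $$\Sigma_F=\Sigma_G .$$
   Context: A control system here is an autonomous equation $y''=F(y,y',u)$ with scalar state $y$, scalar control $u$ and smooth $F$; it is identified with the function $F(u,y,y_1)$ on a domain of $\mathbb{R}^3$ with coordinates $(u,y,y_1)$, where $y_1$ stands for $y'$. A feedback transformation is a (local) diffeomorphism $\Phi:(u,y,t)\mapsto(U(u,y),Y(y),t)$. It acts on $(u,y,y_1)$-space by $(u,y,y_1)\mapsto(U(u,y),Y(y),Y'(y)y_1)$ and on systems by $$\widehat\Phi(F)(y,y_1,u)=\frac1{Y'}F(Y,Y'y_1,U)-\frac{Y''}{Y'}y_1^2 .$$ Systems $F$ and $G$ are locally feedback equivalent if there is a local feedback transformation $\Phi$, relating their (sufficiently small) domains of definition through the action $(u,y,y_1)\mapsto(U(u,y),Y(y),Y'(y)y_1)$ on $(u,y,y_1)$-space, with $\widehat\Phi(F)=G$. Regard $f=F(y,y_1,u)$ as a section of the bundle $\kappa:\mathbb{R}^4\to\mathbb{R}^3$, $(y,y_1,u,f)\mapsto(y,y_1,u)$, with jet coordinates $f,f_u,f_y,f_{y_1},\dots$ and total derivatives $\frac{d}{du},\frac{d}{dy},\frac{d}{dy_1}$. Put $$\nabla_u=\frac{y_1}{f_u}\frac{d}{du},\qquad \nabla_{y_1}=y_1\frac{d}{dy_1},$$ $$J=\frac{y_1f_{y_1}-2f}{y_1},\qquad J_u=\nabla_uJ=\frac{y_1f_{y_1u}-2f_u}{f_u},\qquad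 J_{y_1}=\nabla_{y_1}J=\frac{y_1^2f_{y_1y_1}-2y_1f_{y_1}+2f}{y_1},$$ $J_{uu}=\nabla_u\nabla_uJ$, $J_{uy_1}=\nabla_u\nabla_{y_1}J$, $J_{y_1u}=\nabla_{y_1}\nabla_uJ$, $J_{y_1y_1}=\nabla_{y_1}\nabla_{y_1}J$, and $$K=y_1^2f_{yy_1y_1}-\frac{3y_1J_u+y_1J_{y_1u}}{J_u}f_{yy_1}-y_1J_uf_{yy_1}+\frac{2(J_{y_1u}+2J_u)}{J_u}f_y+2J_uf_y-\frac{(J_uJ_{y_1}+J_{y_1}-J_{y_1y_1})J_u+J_{y_1}J_{y_1u}}{y_1J_u}f+\frac{(J_u-J_{y_1})(J_{y_1y_1}+J_{y_1})}{J_u},$$ $$L=\frac{y_1^2}{f_u}f_{uyy_1}-\frac{(2+J_u)y_1}{f_u}f_{uy}-\frac{y_1J_{uu}}{J_u}f_{yy_1}+2\frac{J_{uu}}{J_u}f_y+\left(\frac{J_{y_1u}}{y_1}-\frac{J_{y_1}J_{uu}}{y_1J_u}\right)f+J_{y_1}+J_{y_1y_1}.$$ These are feedback differential invariants. A superscript $F$ means evaluation on the jets of $F$. Let $\mathbb{R}^8$ have coordinates $(j,j_1,j_3,j_{11},j_{13},j_{33},k,l)$. A system $F$ on a domain $D_F$ defines the map $\sigma_F:D_F\to\mathbb{R}^8$, $$j=J^F,\ j_1=J_u^F,\ j_3=J_{y_1}^F,\ j_{11}=J_{uu}^F,\ j_{13}=J_{uy_1}^F,\ j_{33}=J_{y_1y_1}^F,\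 k=K^F,\ l=L^F,$$ and $\Sigma_F=\operatorname{Im}(\sigma_F)=\sigma_F(D_F)\subset\mathbb{R}^8$. A system $F$ is regular in a domain $D\subset\mathbb{R}^3$ if: (1) the $3$-jets of $F$ at points of $D$ belong to regular orbits, i.e. $y_1\ne0$, $F_u\neq0$ and $J_u^F\neq0$ on $D$; (2) $\sigma_F(D)$ is a smooth $3$-dimensional submanifold of $\mathbb{R}^8$; (3) the functions $j,j_1,j_3$ are coordinates on $\Sigma_F$. *)

theory Defs
  imports "HOL-Analysis.Analysis"
begin

section \<open>Smooth maps, diffeomorphisms, submanifolds\<close>

text \<open>Only meant for open sets \<open>S\<close>.\<close>

primrec Ck_on :: "nat \<Rightarrow> ('a::real_normed_vector \<Rightarrow> 'b::real_normed_vector) \<Rightarrow> 'a set \<Rightarrow> bool"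
  where
    "Ck_on 0 f S \<longleftrightarrow> continuous_on S f"
  | "Ck_on (Suc k) f S \<longleftrightarrow>
       (\<forall>x\<in>S. f differentiable (at x)) \<and>
       (\<forall>v. Ck_on k (\<lambda>x. frechet_derivative f (at x) v) S)"

definition smooth_on :: "('a::real_normed_vector \<Rightarrow> 'b::real_normed_vector) \<Rightarrow> 'a set \<Rightarrow> bool"
  where "smooth_on f S \<longleftrightarrow> (\<forall>k. Ck_on k f S)"

definition diffeo_on :: "('a::real_normed_vector \<Rightarrow> 'b::real_normed_vector) \<Rightarrow> 'a set \<Rightarrow> bool"
  where "diffeo_on f S \<longleftrightarrow>
    open S \<and> smooth_on f S \<and> inj_on f S \<and> open (f ` S) \<and> smooth_on (inv_into S f) (f ` S)"

text \<open>Embedded submanifolds, by slice charts.\<close>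

definition smooth_submanifold :: "nat \<Rightarrow> 'a::euclidean_space set \<Rightarrow> bool"
  where "smooth_submanifold k S \<longleftrightarrow>
    (\<forall>x\<in>S. \<exists>N (\<phi> :: 'a \<Rightarrow> 'a) T. x \<in> N \<and> diffeo_on \<phi> N \<and> subspace T \<and> dim T = k \<and>
       \<phi> ` (S \<inter> N) = \<phi> ` N \<inter> T)"

text \<open>The components of \<open>c\<close> are coordinates on the submanifold \<open>S\<close> in a neighbourhood of each
  of its points; global injectivity of \<open>c\<close> on \<open>S\<close> is not required.\<close>

definition coordinates_on :: "('a::euclidean_space \<Rightarrow> 'b::euclidean_space) \<Rightarrow> 'a set \<Rightarrow> bool"
  where "coordinates_on c S \<longleftrightarrow>
    (\<forall>x\<in>S. \<exists>N. open N \<and> x \<in> N \<and> smooth_on c N \<and> inj_on c (S \<inter> N) \<and>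
       open (c ` (S \<inter> N)) \<and> smooth_on (inv_into (S \<inter> N) c) (c ` (S \<inter> N)))"

section \<open>Differential invariants of control systems\<close>

text \<open>A point \<open>(u, y, p)\<close> consists of the control \<open>u\<close>, the state \<open>y\<close> and \<open>p = y'\<close>.
  Evaluated on the jets of a system, total derivatives are partial derivatives of functions of
  \<open>(u, y, p)\<close>.\<close>

type_synonym point = "real \<times> real \<times> real"
type_synonym scalar = "point \<Rightarrow> real"

definition D_u :: "scalar \<Rightarrow> scalar"
  where "D_u h = (\<lambda>(u, y, p). deriv (\<lambda>s. h (s, y, p)) u)"

definition D_y :: "scalar \<Rightarrow> scalar"
  where "D_y h = (\<lambda>(u, y, p). deriv (\<lambda>s. h (u, s, p)) y)"

definition D_p :: "scalar \<Rightarrow> scalar"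
  where "D_p h = (\<lambda>(u, y, p). deriv (\<lambda>s. h (u, y, s)) p)"

definition nabla_u :: "scalar \<Rightarrow> scalar \<Rightarrow> scalar"
  where "nabla_u F h = (\<lambda>(u, y, p). p / D_u F (u, y, p) * D_u h (u, y, p))"

definition nabla_p :: "scalar \<Rightarrow> scalar"
  where "nabla_p h = (\<lambda>(u, y, p). p * D_p h (u, y, p))"

definition inv_J :: "scalar \<Rightarrow> scalar"
  where "inv_J F = (\<lambda>(u, y, p). (p * D_p F (u, y, p) - 2 * F (u, y, p)) / p)"

text \<open>As in the usual notation, the indices give the order of composition:
  \<open>inv_Jup F\<close> is \<open>nabla_u\<close> applied to \<open>nabla_p (inv_J F)\<close>.\<close>

definition inv_Ju :: "scalar \<Rightarrow> scalar"
  where "inv_Ju F = nabla_u F (inv_J F)"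

definition inv_Jp :: "scalar \<Rightarrow> scalar"
  where "inv_Jp F = nabla_p (inv_J F)"

definition inv_Juu :: "scalar \<Rightarrow> scalar"
  where "inv_Juu F = nabla_u F (nabla_u F (inv_J F))"

definition inv_Jup :: "scalar \<Rightarrow> scalar"
  where "inv_Jup F = nabla_u F (nabla_p (inv_J F))"

definition inv_Jpu :: "scalar \<Rightarrow> scalar"
  where "inv_Jpu F = nabla_p (nabla_u F (inv_J F))"

definition inv_Jpp :: "scalar \<Rightarrow> scalar"
  where "inv_Jpp F = nabla_p (nabla_p (inv_J F))"

definition inv_K :: "scalar \<Rightarrow> scalar"
  where "inv_K F = (\<lambda>(u, y, p).
    let x = (u, y, p); f = F x; f_y = D_y F x; f_yp = D_p (D_y F) x; f_ypp = D_p (D_p (D_y F)) x;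
        J_u = inv_Ju F x; J_p = inv_Jp F x; J_pu = inv_Jpu F x; J_pp = inv_Jpp F x
    in p\<^sup>2 * f_ypp - (3 * p * J_u + p * J_pu) / J_u * f_yp - p * J_u * f_yp
       + 2 * (J_pu + 2 * J_u) / J_u * f_y + 2 * J_u * f_y
       - ((J_u * J_p + J_p - J_pp) * J_u + J_p * J_pu) / (p * J_u) * f
       + (J_u - J_p) * (J_pp + J_p) / J_u)"

definition inv_L :: "scalar \<Rightarrow> scalar"
  where "inv_L F = (\<lambda>(u, y, p).
    let x = (u, y, p); f = F x; f_u = D_u F x; f_y = D_y F x; f_uy = D_y (D_u F) x;
        f_yp = D_p (D_y F) x; f_uyp = D_p (D_y (D_u F)) x;
        J_u = inv_Ju F x; J_p = inv_Jp F x;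
        J_uu = inv_Juu F x; J_pu = inv_Jpu F x; J_pp = inv_Jpp F x
    in p\<^sup>2 / f_u * f_uyp - (2 + J_u) * p / f_u * f_uy - p * J_uu / J_u * f_yp
       + 2 * (J_uu / J_u) * f_y + (J_pu / p - J_p * J_uu / (p * J_u)) * f
       + J_p + J_pp)"

text \<open>\<open>\<real>\<^sup>8\<close> with coordinates \<open>(j, j1, j3, j11, j13, j33, k, l)\<close>.\<close>

type_synonym R8 = "real \<times> real \<times> real \<times> real \<times> real \<times> real \<times> real \<times> real"

definition \<sigma> :: "scalar \<Rightarrow> point \<Rightarrow> R8"
  where "\<sigma> F x = (inv_J F x, inv_Ju F x, inv_Jp F x, inv_Juu F x, inv_Jup F x, inv_Jpp F x,
                   inv_K F x, inv_L F x)"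

definition \<Sigma> :: "scalar \<Rightarrow> point set \<Rightarrow> R8 set"
  where "\<Sigma> F D = \<sigma> F ` D"

definition coord_j_j1_j3 :: "R8 \<Rightarrow> real \<times> real \<times> real"
  where "coord_j_j1_j3 = (\<lambda>(j, j1, j3, j11, j13, j33, k, l). (j, j1, j3))"

section \<open>Regular systems and feedback equivalence\<close>

definition is_domain :: "'a::topological_space set \<Rightarrow> bool"
  where "is_domain D \<longleftrightarrow> open D \<and> connected D \<and> D \<noteq> {}"

definition control_system :: "scalar \<Rightarrow> point set \<Rightarrow> bool"
  where "control_system F D \<longleftrightarrow> is_domain D \<and> smooth_on F D"

definition regular_system :: "scalar \<Rightarrow> point set \<Rightarrow> bool"
  where "regular_system F D \<longleftrightarrow>
    control_system F D \<and>
    (\<forall>(u, y, p)\<in>D. p \<noteq> 0 \<and> D_u F (u, y, p) \<noteq> 0 \<and> inv_Ju F (u, y, p) \<noteq> 0) \<and>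
    smooth_submanifold 3 (\<Sigma> F D) \<and>
    coordinates_on coord_j_j1_j3 (\<Sigma> F D)"

text \<open>The map \<open>(u, y, t) \<mapsto> (U(u, y), Y(y), t)\<close> on \<open>W \<times> \<real>\<close>, where \<open>W\<close> is a set of pairs \<open>(u, y)\<close>.\<close>

definition feedback_transformation ::
    "(real \<times> real) set \<Rightarrow> (real \<times> real \<Rightarrow> real) \<Rightarrow> (real \<Rightarrow> real) \<Rightarrow> bool"
  where "feedback_transformation W U Y \<longleftrightarrow>
    diffeo_on (\<lambda>(u, y, t::real). (U (u, y), Y y, t)) {(u, y, t). (u, y) \<in> W}"

definition point_action :: "(real \<times> real \<Rightarrow> real) \<Rightarrow> (real \<Rightarrow> real) \<Rightarrow> point \<Rightarrow> point"
  where "point_action U Y = (\<lambda>(u, y, p). (U (u, y), Y y, deriv Y y * p))"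

definition system_action :: "(real \<times> real \<Rightarrow> real) \<Rightarrow> (real \<Rightarrow> real) \<Rightarrow> scalar \<Rightarrow> scalar"
  where "system_action U Y F = (\<lambda>(u, y, p).
    1 / deriv Y y * F (U (u, y), Y y, deriv Y y * p) - deriv (deriv Y) y / deriv Y y * p\<^sup>2)"

text \<open>Since \<open>system_action U Y F\<close> at \<open>x\<close> evaluates \<open>F\<close> at \<open>point_action U Y x\<close>, the action on points
  maps the domain \<open>B\<close> of \<open>G\<close> onto the domain \<open>A\<close> of \<open>F\<close>.\<close>

definition feedback_related :: "scalar \<Rightarrow> point set \<Rightarrow> scalar \<Rightarrow> point set \<Rightarrow> bool"
  where "feedback_related F A G B \<longleftrightarrow>
    (\<exists>W U Y. feedback_transformation W U Y \<and> B \<subseteq> {(u, y, p). (u, y) \<in> W} \<and>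
       point_action U Y ` B = A \<and> (\<forall>x\<in>B. system_action U Y F x = G x))"

text \<open>Local equivalence of \<open>F\<close> on \<open>DF\<close> and \<open>G\<close> on \<open>DG\<close>: around every point of either domain, a
  feedback transformation relates sufficiently small subdomains of \<open>DF\<close> and \<open>DG\<close>. One
  transformation relating all of \<open>DF\<close> and \<open>DG\<close> would be a global notion, which equality of the
  images does not imply: for a system that is periodic in \<open>y\<close>, two boxes of different lengths in
  \<open>y\<close>, both longer than a period, have the same image.\<close>

definition locally_feedback_equivalent ::
    "scalar \<Rightarrow> point set \<Rightarrow> scalar \<Rightarrow> point set \<Rightarrow> bool"
  where "locally_feedback_equivalent F DF G DG \<longleftrightarrow>
    (\<forall>a\<in>DF. \<exists>A B. is_domain A \<and> is_domain B \<and> A \<subseteq> DF \<and> B \<subseteq> DG \<and> a \<in> A \<and>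
       feedback_related F A G B) \<and>
    (\<forall>b\<in>DG. \<exists>A B. is_domain A \<and> is_domain B \<and> A \<subseteq> DF \<and> B \<subseteq> DG \<and> b \<in> B \<and>
       feedback_related F A G B)"

end

theory Submission
  imports Defs
begin

text \<open>
  The vector fields \<open>\<nabla>\<^sub>u\<close>, \<open>\<nabla>\<^sub>p\<close> and the total derivative, corrected by a multiple of
  \<open>\<nabla>\<^sub>u\<close> so that it annihilates \<open>J\<close>, form an invariant frame of the \<open>(u, y, p)\<close>-space. Up to functions
  of the other invariants, \<open>K\<close> and \<open>L\<close> are the derivatives of \<open>J\<^sub>p\<close> and \<open>J\<^sub>u\<close> along the third field, so
  the derivatives of \<open>H = (J, J\<^sub>u, J\<^sub>p)\<close> along the frame are functions of \<open>\<sigma>\<close>. Invariance of the frame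
  gives invariance of \<open>\<sigma>\<close>.

  Conversely, near a point of \<open>\<Sigma>\<close> these derivatives are functions \<open>n\<^sub>i(H)\<close> of \<open>H\<close> alone, the same ones
  for both systems. Hence \<open>H\<close> satisfies a closed differential equation, by which the Jacobian of \<open>H\<close>
  vanishes nowhere or everywhere on the domain; the latter is excluded by Sard's theorem, since \<open>H\<close>
  maps onto open sets. So \<open>\<Phi> = H\<^sub>F\<inverse> \<circ> H\<^sub>G\<close> is a local diffeomorphism that carries the frame of \<open>G\<close> to
  the frame of \<open>F\<close>, and written out in coordinates this says that \<open>\<Phi>\<close> is the action of a feedback
  transformation taking \<open>F\<close> to \<open>G\<close>.
\<close>

section \<open>Calculus of smooth maps\<close>

text \<open>Regularity constrains only the image of \<open>\<sigma> F\<close>, not the map: t |->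
  t^3 has the whole line as its image and is still critical at 0. So the rank of \<open>H\<close>
  has to be derived. The eight coordinates come from a count. Three functions and three fields give
  nine derivatives. Those of \<open>J\<close> are \<open>J\<^sub>u\<close>, 0 and
  \<open>J\<^sub>p\<close>, and the commutator of \<open>\<nabla>\<^sub>u\<close> and
  \<open>\<nabla>\<^sub>p\<close> relates \<open>\<nabla>\<^sub>p J\<^sub>u\<close> to
  \<open>\<nabla>\<^sub>u J\<^sub>p\<close>. The five that remain are, up to functions of the other
  invariants, \<open>j11\<close>, \<open>j13\<close>, \<open>j33\<close>, \<open>k\<close> and
  \<open>l\<close>, which is why the equation for \<open>H\<close> closes. The triangular form of a
  feedback transformation appears because \<open>\<nabla>\<^sub>u\<close> and
  \<open>\<nabla>\<^sub>p\<close> are multiples of the coordinate fields of \<open>u\<close> and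
  \<open>p\<close>: preserving them decides which variables each component of \<open>\<Phi>\<close>
  depends on. The third field then forces the factor \<open>Y'\<close> on \<open>p\<close> and the
  transformation law of systems.\<close>

lemma Ck_on_imp_continuous_on:
  assumes "Ck_on k f S"
  shows "continuous_on S f"
proof (cases k)
  case 0
  with assms show ?thesis by simp
next
  case (Suc n)
  with assms have "\<forall>x\<in>S. f differentiable (at x)" by simp
  then show ?thesis
    by (intro differentiable_imp_continuous_on differentiable_at_imp_differentiable_on) auto
qed

lemma Ck_on_SucD: "Ck_on (Suc k) f S \<Longrightarrow> Ck_on k f S"
proof (induction k arbitrary: f)
  case 0
  then show ?case using Ck_on_imp_continuous_on[OF 0] by simp
next
  case (Suc k)
  note * = Suc.prems[unfolded Ck_on.simps(2)[of "Suc k"]]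
  show ?case
    unfolding Ck_on.simps(2)[of k] using * Suc.IH by blast
qed

lemma Ck_on_subset: "Ck_on k f S \<Longrightarrow> T \<subseteq> S \<Longrightarrow> Ck_on k f T"
  by (induction k arbitrary: f) (auto intro: continuous_on_subset)

text \<open>On an open set, agreement at the points of the set is agreement near each of them, and
  this is what \<open>frechet_derivative\<close> sees.\<close>

lemma Ck_on_cong_imp:
  assumes "open S" "\<And>x. x \<in> S \<Longrightarrow> f x = g x" "Ck_on k f S"
  shows "Ck_on k g S"
  using assms(2,3)
proof (induction k arbitrary: f g)
  case 0
  then show ?case by (simp cong: continuous_on_cong)
next
  case (Suc k)
  have d: "(g has_derivative frechet_derivative f (at x)) (at x)" if "x \<in> S" for x
  proof -
    have "(f has_derivative frechet_derivative f (at x)) (at x)"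
      using Suc.prems that by (simp add: frechet_derivative_works)
    then show ?thesis
      by (rule has_derivative_transform_within_open[OF _ \<open>open S\<close> that]) (use Suc.prems in auto)
  qed
  have eq: "frechet_derivative f (at x) v = frechet_derivative g (at x) v" if "x \<in> S" for x v
    using frechet_derivative_at[OF d[OF that]] by simp
  have "Ck_on k (\<lambda>x. frechet_derivative g (at x) v) S" for v
    by (rule Suc.IH[of "\<lambda>x. frechet_derivative f (at x) v"]) (use Suc.prems eq in auto)
  then show ?case using d by (auto intro: differentiableI)
qed

lemma Ck_on_cong:
  assumes "open S" "\<And>x. x \<in> S \<Longrightarrow> f x = g x"
  shows "Ck_on k f S \<longleftrightarrow> Ck_on k g S"
  using Ck_on_cong_imp[OF assms(1), of f g k] Ck_on_cong_imp[OF assms(1), of g f k] assms(2)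
  by metis

text \<open>The induction steps of the closure lemmas go through this rule: it suffices to exhibit a
  derivative by a formula and to control that formula in each fixed direction.\<close>

lemma Ck_on_SucI:
  assumes "open S" and d: "\<And>x. x \<in> S \<Longrightarrow> (f has_derivative f' x) (at x)"
    and "\<And>v. Ck_on k (\<lambda>x. f' x v) S"
  shows "Ck_on (Suc k) f S"
proof -
  have "Ck_on k (\<lambda>x. frechet_derivative f (at x) v) S" for v
    by (rule Ck_on_cong_imp[OF assms(1) _ assms(3)[of v]]) (use frechet_derivative_at[OF d] in metis)
  then show ?thesis using d by (auto intro: differentiableI)
qed

lemma Ck_on_SucE:
  assumes "Ck_on (Suc k) f S"
  shows "\<And>x. x \<in> S \<Longrightarrow> (f has_derivative frechet_derivative f (at x)) (at x)"
    and "\<And>v. Ck_on k (\<lambda>x. frechet_derivative f (at x) v) S"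
  using assms by (simp_all add: frechet_derivative_works)

lemma Ck_on_const: "Ck_on k (\<lambda>x. c) S"
  by (induction k arbitrary: c) auto

lemma Ck_on_linear:
  assumes T: "bounded_linear T" and S: "open S" and f: "Ck_on k f S"
  shows "Ck_on k (\<lambda>x. T (f x)) S"
  using f
proof (induction k arbitrary: f)
  case 0
  then show ?case using T by (auto intro: linear_continuous_on_compose linear_continuous_on bounded_linear.continuous_on)
next
  case (Suc k)
  show ?case
    by (rule Ck_on_SucI[OF S bounded_linear.has_derivative[OF T Ck_on_SucE(1)[OF Suc.prems]]])
       (auto intro!: Suc.IH Ck_on_SucE(2)[OF Suc.prems])
qed

lemma Ck_on_add:
  assumes S: "open S" and "Ck_on k f S" "Ck_on k g S"
  shows "Ck_on k (\<lambda>x. f x + g x) S"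
  using assms(2,3)
proof (induction k arbitrary: f g)
  case 0
  then show ?case by (auto intro: continuous_intros)
next
  case (Suc k)
  show ?case
    by (rule Ck_on_SucI[OF S has_derivative_add[OF Ck_on_SucE(1)[OF Suc.prems(1)] Ck_on_SucE(1)[OF Suc.prems(2)]]])
       (auto intro!: Suc.IH Ck_on_SucE(2)[OF Suc.prems(1)] Ck_on_SucE(2)[OF Suc.prems(2)])
qed

lemma Ck_on_sum:
  assumes "open S" "\<And>i. i \<in> I \<Longrightarrow> Ck_on k (f i) S"
  shows "Ck_on k (\<lambda>x. \<Sum>i\<in>I. f i x) S"
  using assms(2) by (induction I rule: infinite_finite_induct) (auto intro!: Ck_on_const Ck_on_add assms(1))

lemma Ck_on_bilinear:
  assumes B: "bounded_bilinear B" and S: "open S" and "Ck_on k f S" "Ck_on k g S"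
  shows "Ck_on k (\<lambda>x. B (f x) (g x)) S"
  using assms(3,4)
proof (induction k arbitrary: f g)
  case 0
  then show ?case using bounded_bilinear.continuous_on[OF B] by auto
next
  case (Suc k)
  show ?case
    by (rule Ck_on_SucI[OF S bounded_bilinear.FDERIV[OF B Ck_on_SucE(1)[OF Suc.prems(1)] Ck_on_SucE(1)[OF Suc.prems(2)]]])
       (auto intro!: Ck_on_add S Suc.IH Ck_on_SucE(2)[OF Suc.prems(1)] Ck_on_SucE(2)[OF Suc.prems(2)]
          Ck_on_SucD[OF Suc.prems(1)] Ck_on_SucD[OF Suc.prems(2)])
qed

text \<open>The derivative of 1/f is -(1/f) f' (1/f), so the induction hypothesis for 1/f itself,
  together with the product rule, controls it.\<close>

lemma Ck_on_inverse:
  fixes f :: "'a::real_normed_vector \<Rightarrow> real"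
  assumes S: "open S" and "Ck_on k f S" and nz: "\<And>x. x \<in> S \<Longrightarrow> f x \<noteq> 0"
  shows "Ck_on k (\<lambda>x. inverse (f x)) S"
  using assms(2)
proof (induction k)
  case 0
  then show ?case using nz by (auto intro: continuous_intros)
next
  case (Suc k)
  have m: "Ck_on k (\<lambda>x. a x * b x) S" if "Ck_on k a S" "Ck_on k b S" for a b :: "'a \<Rightarrow> real"
    using Ck_on_bilinear[OF bounded_bilinear_mult S that] .
  have IH: "Ck_on k (\<lambda>x. inverse (f x)) S"
    using Suc Ck_on_SucD by blast
  have "Ck_on k (\<lambda>x. - (inverse (f x) * frechet_derivative f (at x) v * inverse (f x))) S" for v
    by (intro Ck_on_linear[OF bounded_linear_minus[OF bounded_linear_ident] S] m IH Ck_on_SucE(2)[OF Suc.prems])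
  then show ?case
    by (intro Ck_on_SucI[OF S Deriv.has_derivative_inverse[OF nz Ck_on_SucE(1)[OF Suc.prems]]])
qed

text \<open>In the chain rule the direction \<open>?Df x v\<close> varies with the point, while the
  induction hypothesis speaks of derivatives of \<open>g\<close> in fixed directions. Expanding the
  direction in the finite basis of the middle space reduces to these, with scalar coefficients that
  are again \<open>Ck_on k\<close>.\<close>

lemma Ck_on_compose:
  fixes f :: "'a::real_normed_vector \<Rightarrow> 'b::euclidean_space" and g :: "'b \<Rightarrow> 'c::real_normed_vector"
  assumes S: "open S" and T: "open T" and sub: "\<And>x. x \<in> S \<Longrightarrow> f x \<in> T"
    and "Ck_on k g T" "Ck_on k f S"
  shows "Ck_on k (\<lambda>x. g (f x)) S"
  using assms(4,5)
proof (induction k arbitrary: g)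
  case 0
  then show ?case using sub by (auto intro!: continuous_on_compose2[of T g S f])
next
  case (Suc k)
  let ?Dg = "\<lambda>y. frechet_derivative g (at y)" and ?Df = "\<lambda>x. frechet_derivative f (at x)"
  have d: "((\<lambda>x. g (f x)) has_derivative (\<lambda>v. ?Dg (f x) (?Df x v))) (at x)" if "x \<in> S" for x
    using diff_chain_at[OF Ck_on_SucE(1)[OF Suc.prems(2) that] Ck_on_SucE(1)[OF Suc.prems(1) sub[OF that]]]
    by (simp add: o_def)
  have lin: "linear (?Dg (f x))" if "x \<in> S" for x
    using Ck_on_SucE(1)[OF Suc.prems(1) sub[OF that]] has_derivative_linear by blast
  have "Ck_on k (\<lambda>x. \<Sum>b\<in>Basis. (?Df x v \<bullet> b) *\<^sub>R ?Dg (f x) b) S" for v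
    by (intro Ck_on_sum S Ck_on_bilinear[OF bounded_bilinear_scaleR S] Suc.IH Ck_on_SucE(2)[OF Suc.prems(1)]
          Ck_on_SucD[OF Suc.prems(2)] Ck_on_linear[OF bounded_linear_inner_left S Ck_on_SucE(2)[OF Suc.prems(2)]])
  then have "Ck_on k (\<lambda>x. ?Dg (f x) (?Df x v)) S" for v
  proof (rule Ck_on_cong_imp[OF S, rotated])
    fix x assume "x \<in> S"
    have "?Dg (f x) (?Df x v) = ?Dg (f x) (\<Sum>b\<in>Basis. (?Df x v \<bullet> b) *\<^sub>R b)"
      by (simp only: euclidean_representation)
    also have "\<dots> = (\<Sum>b\<in>Basis. (?Df x v \<bullet> b) *\<^sub>R ?Dg (f x) b)"
      using lin[OF \<open>x \<in> S\<close>] by (simp add: linear_sum linear_cmul)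
    finally show "(\<Sum>b\<in>Basis. (?Df x v \<bullet> b) *\<^sub>R ?Dg (f x) b) = ?Dg (f x) (?Df x v)" by simp
  qed
  then show ?case by (intro Ck_on_SucI[OF S d])
qed

lemma Ck_on_Pair:
  assumes "open S" "Ck_on k f S" "Ck_on k g S"
  shows "Ck_on k (\<lambda>x. (f x, g x)) S"
proof -
  have "Ck_on k (\<lambda>x. (f x, 0) + (0, g x)) S"
    by (intro Ck_on_add assms Ck_on_linear[of "\<lambda>a. (a, 0)" _ _ f] Ck_on_linear[of "\<lambda>b. (0, b)" _ _ g]
        bounded_linear_Pair bounded_linear_ident bounded_linear_zero)
  then show ?thesis by simp
qed

section \<open>Closure rules for smooth maps\<close>

lemma smooth_on_cong: "open S \<Longrightarrow> (\<And>x. x \<in> S \<Longrightarrow> f x = g x) \<Longrightarrow> smooth_on f S \<longleftrightarrow> smooth_on g S"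
  unfolding smooth_on_def using Ck_on_cong by metis

lemma smooth_on_subset: "smooth_on f S \<Longrightarrow> T \<subseteq> S \<Longrightarrow> smooth_on f T"
  unfolding smooth_on_def using Ck_on_subset by blast

lemma smooth_on_const [intro]: "smooth_on (\<lambda>x. c) S"
  unfolding smooth_on_def using Ck_on_const by blast

lemma smooth_on_linear:
  "bounded_linear T \<Longrightarrow> open S \<Longrightarrow> smooth_on f S \<Longrightarrow> smooth_on (\<lambda>x. T (f x)) S"
  unfolding smooth_on_def using Ck_on_linear by blast

lemma smooth_on_ident: "smooth_on (\<lambda>x. x) S"
proof -
  have "Ck_on k (\<lambda>x::'a. x) UNIV" for k
    by (cases k) (auto intro: Ck_on_const)
  then show ?thesis
    unfolding smooth_on_def using Ck_on_subset by blast
qed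

lemma smooth_on_add: "open S \<Longrightarrow> smooth_on f S \<Longrightarrow> smooth_on g S \<Longrightarrow> smooth_on (\<lambda>x. f x + g x) S"
  unfolding smooth_on_def using Ck_on_add by blast

lemma smooth_on_minus: "open S \<Longrightarrow> smooth_on f S \<Longrightarrow> smooth_on (\<lambda>x. - f x) S"
  by (rule smooth_on_linear[OF bounded_linear_minus[OF bounded_linear_ident]])

lemma smooth_on_diff: "open S \<Longrightarrow> smooth_on f S \<Longrightarrow> smooth_on g S \<Longrightarrow> smooth_on (\<lambda>x. f x - g x) S"
  using smooth_on_add[of S f "\<lambda>x. - g x"] smooth_on_minus[of S g] by simp

lemma smooth_on_mult:
  fixes f g :: "'a::real_normed_vector \<Rightarrow> real"
  shows "open S \<Longrightarrow> smooth_on f S \<Longrightarrow> smooth_on g S \<Longrightarrow> smooth_on (\<lambda>x. f x * g x) S"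
  unfolding smooth_on_def using Ck_on_bilinear[OF bounded_bilinear_mult] by blast

lemma smooth_on_divide:
  fixes f g :: "'a::real_normed_vector \<Rightarrow> real"
  assumes "open S" "smooth_on f S" "smooth_on g S" "\<And>x. x \<in> S \<Longrightarrow> g x \<noteq> 0"
  shows "smooth_on (\<lambda>x. f x / g x) S"
  unfolding divide_inverse
  using assms by (intro smooth_on_mult) (auto simp: smooth_on_def intro: Ck_on_inverse)

lemma smooth_on_power:
  fixes f :: "'a::real_normed_vector \<Rightarrow> real"
  shows "open S \<Longrightarrow> smooth_on f S \<Longrightarrow> smooth_on (\<lambda>x. f x ^ n) S"
  by (induction n) (auto intro: smooth_on_mult)

lemma smooth_on_Pair: "open S \<Longrightarrow> smooth_on f S \<Longrightarrow> smooth_on g S \<Longrightarrow> smooth_on (\<lambda>x. (f x, g x)) S"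
  unfolding smooth_on_def using Ck_on_Pair by blast

lemma smooth_on_fst: "open S \<Longrightarrow> smooth_on f S \<Longrightarrow> smooth_on (\<lambda>x. fst (f x)) S"
  by (rule smooth_on_linear[OF bounded_linear_fst])

lemma smooth_on_snd: "open S \<Longrightarrow> smooth_on f S \<Longrightarrow> smooth_on (\<lambda>x. snd (f x)) S"
  by (rule smooth_on_linear[OF bounded_linear_snd])

lemma smooth_on_compose:
  fixes f :: "'a::real_normed_vector \<Rightarrow> 'b::euclidean_space"
  assumes "open S" "open T" "\<And>x. x \<in> S \<Longrightarrow> f x \<in> T" "smooth_on g T" "smooth_on f S"
  shows "smooth_on (\<lambda>x. g (f x)) S"
  using assms unfolding smooth_on_def using Ck_on_compose by blast

lemma smooth_on_has_derivative:
  "smooth_on f S \<Longrightarrow> x \<in> S \<Longrightarrow> (f has_derivative frechet_derivative f (at x)) (at x)"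
  unfolding smooth_on_def using Ck_on_SucE(1) by blast

lemma smooth_on_frechet_derivative:
  "smooth_on f S \<Longrightarrow> smooth_on (\<lambda>x. frechet_derivative f (at x) v) S"
  unfolding smooth_on_def using Ck_on_SucE(2) by blast

lemma smooth_on_imp_continuous_on: "smooth_on f S \<Longrightarrow> continuous_on S f"
  unfolding smooth_on_def using Ck_on_imp_continuous_on by blast

lemmas smooth_intros = smooth_on_const smooth_on_ident smooth_on_add smooth_on_diff smooth_on_minus
  smooth_on_mult smooth_on_divide smooth_on_power smooth_on_Pair smooth_on_fst smooth_on_snd

text \<open>Both mixed derivatives are limits of the same second difference quotient.\<close>

lemma second_difference_mean_value:
  fixes f :: "'a::real_normed_vector \<Rightarrow> real"
  assumes S: "\<And>s t. 0 \<le> s \<Longrightarrow> s \<le> h \<Longrightarrow> 0 \<le> t \<Longrightarrow> t \<le> h \<Longrightarrow> x + s *\<^sub>R v + t *\<^sub>R w \<in> S"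
    and f: "smooth_on f S" and h: "h > 0"
  obtains s t where "0 \<le> s" "s \<le> h" "0 \<le> t" "t \<le> h"
    "f (x + h *\<^sub>R v + h *\<^sub>R w) - f (x + h *\<^sub>R v) - f (x + h *\<^sub>R w) + f x
      = h * h * frechet_derivative (\<lambda>z. frechet_derivative f (at z) v) (at (x + s *\<^sub>R v + t *\<^sub>R w)) w"
proof -
  let ?D = "\<lambda>z. frechet_derivative f (at z) v"
  define \<phi> where "\<phi> s = f (x + s *\<^sub>R v + h *\<^sub>R w) - f (x + s *\<^sub>R v)" for s
  have d1: "((\<lambda>s. f (x + s *\<^sub>R v + t *\<^sub>R w)) has_field_derivative ?D (x + s *\<^sub>R v + t *\<^sub>R w)) (at s)"
    if "0 \<le> s" "s \<le> h" "0 \<le> t" "t \<le> h" for s t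
  proof -
    let ?z = "x + s *\<^sub>R v + t *\<^sub>R w"
    have 1: "(f has_derivative frechet_derivative f (at ?z)) (at ?z)"
      using smooth_on_has_derivative[OF f S[OF that]] .
    have 2: "((\<lambda>s. x + s *\<^sub>R v + t *\<^sub>R w) has_derivative (\<lambda>r. r *\<^sub>R v)) (at s)"
      by (auto intro!: derivative_eq_intros)
    have "((\<lambda>s. f (x + s *\<^sub>R v + t *\<^sub>R w)) has_derivative (\<lambda>r. frechet_derivative f (at ?z) (r *\<^sub>R v))) (at s)"
      using diff_chain_at[OF 2 1] by (simp add: o_def)
    then show ?thesis
      using has_derivative_linear[OF 1] by (simp add: has_field_derivative_def linear_cmul mult_commute_abs)
  qed
  have "(\<phi> has_field_derivative (?D (x + s *\<^sub>R v + h *\<^sub>R w) - ?D (x + s *\<^sub>R v))) (at s)"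
    if "0 \<le> s" "s \<le> h" for s
    unfolding \<phi>_def using d1[OF that, of h] d1[OF that, of 0] h by (auto intro!: DERIV_diff)
  from MVT2[OF h this] obtain s where s: "0 < s" "s < h"
    and eq1: "\<phi> h - \<phi> 0 = h * (?D (x + s *\<^sub>R v + h *\<^sub>R w) - ?D (x + s *\<^sub>R v))"
    by auto
  define D2 where "D2 z = frechet_derivative ?D (at z) w" for z
  have "((\<lambda>t. ?D (x + s *\<^sub>R v + t *\<^sub>R w)) has_field_derivative D2 (x + s *\<^sub>R v + t *\<^sub>R w)) (at t)"
    if "0 \<le> t" "t \<le> h" for t
  proof -
    let ?z = "x + s *\<^sub>R v + t *\<^sub>R w"
    have 1: "(?D has_derivative frechet_derivative ?D (at ?z)) (at ?z)"
      using smooth_on_has_derivative[OF smooth_on_frechet_derivative[OF f] S] s that by simp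
    have 2: "((\<lambda>t. x + s *\<^sub>R v + t *\<^sub>R w) has_derivative (\<lambda>r. r *\<^sub>R w)) (at t)"
      by (auto intro!: derivative_eq_intros)
    have "((\<lambda>t. ?D (x + s *\<^sub>R v + t *\<^sub>R w)) has_derivative (\<lambda>r. frechet_derivative ?D (at ?z) (r *\<^sub>R w))) (at t)"
      using diff_chain_at[OF 2 1] by (simp add: o_def)
    then show ?thesis
      using has_derivative_linear[OF 1]
      by (simp add: D2_def has_field_derivative_def linear_cmul mult_commute_abs)
  qed
  from MVT2[OF h this] obtain t where t: "0 < t" "t < h"
    and eq2: "?D (x + s *\<^sub>R v + h *\<^sub>R w) - ?D (x + s *\<^sub>R v) = h * D2 (x + s *\<^sub>R v + t *\<^sub>R w)"
    by auto
  show thesis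
    by (rule that[of s t]) (use s t eq1 eq2 in \<open>auto simp: \<phi>_def D2_def algebra_simps\<close>)
qed

lemma mixed_derivatives_commute:
  fixes f :: "'a::real_normed_vector \<Rightarrow> real"
  assumes S: "open S" and f: "smooth_on f S" and x: "x \<in> S"
  shows "frechet_derivative (\<lambda>z. frechet_derivative f (at z) v) (at x) w
       = frechet_derivative (\<lambda>z. frechet_derivative f (at z) w) (at x) v"
proof -
  define P where "P z = frechet_derivative (\<lambda>z. frechet_derivative f (at z) v) (at z) w" for z
  define Q where "Q z = frechet_derivative (\<lambda>z. frechet_derivative f (at z) w) (at z) v" for z
  have cont: "continuous_on S P" "continuous_on S Q"
    unfolding P_def Q_def by (intro smooth_on_imp_continuous_on smooth_on_frechet_derivative f)+
  have "\<bar>P x - Q x\<bar> < e" if "e > 0" for e :: real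
  proof -
    have "isCont P x" "isCont Q x"
      using cont S x by (auto simp: continuous_on_eq_continuous_at)
    then obtain d1 d2 where d: "d1 > 0" "d2 > 0"
      "\<And>z. dist z x < d1 \<Longrightarrow> dist (P z) (P x) < e / 2" "\<And>z. dist z x < d2 \<Longrightarrow> dist (Q z) (Q x) < e / 2"
      unfolding continuous_at_eps_delta using \<open>e > 0\<close> by (metis half_gt_zero)
    obtain d3 where d3: "d3 > 0" "ball x d3 \<subseteq> S"
      using S x openE by blast
    define d where "d = min d3 (min d1 d2)"
    have dpos: "d > 0" using d d3 by (simp add: d_def)
    \<comment> \<open>With this side length the parallelogram spanned by
      \<open>h *\<^sub>R v\<close> and \<open>h *\<^sub>R w\<close> stays within distance
      \<open>d\<close> of \<open>x\<close>. The summand 1 keeps the denominator positive when both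
      vectors vanish and makes the estimate strict.\<close>
    define h where "h = d / (norm v + norm w + 1)"
    have nn: "norm v + norm w + 1 > 0" by (smt (verit) norm_ge_zero)
    then have h: "h > 0" using dpos by (simp add: h_def)
    have near: "dist (x + s *\<^sub>R v + t *\<^sub>R w) x < d" if "0 \<le> s" "s \<le> h" "0 \<le> t" "t \<le> h" for s t
    proof -
      have "dist (x + s *\<^sub>R v + t *\<^sub>R w) x = norm (s *\<^sub>R v + t *\<^sub>R w)"
        by (simp add: dist_norm algebra_simps)
      also have "\<dots> \<le> s * norm v + t * norm w"
        using norm_triangle_ineq[of "s *\<^sub>R v" "t *\<^sub>R w"] that by simp
      also have "\<dots> \<le> h * norm v + h * norm w"
        using that by (intro add_mono mult_right_mono) auto
      also have "\<dots> < h * (norm v + norm w + 1)" using h by (simp add: algebra_simps)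
      also have "\<dots> = d" using nn by (simp add: h_def)
      finally show ?thesis .
    qed
    have inS: "x + s *\<^sub>R v + t *\<^sub>R w \<in> S" if "0 \<le> s" "s \<le> h" "0 \<le> t" "t \<le> h" for s t
      using near[OF that] d3 by (auto simp: d_def mem_ball dist_commute)
    have inS': "x + s *\<^sub>R w + t *\<^sub>R v \<in> S" if "0 \<le> s" "s \<le> h" "0 \<le> t" "t \<le> h" for s t
      using inS[OF that(3,4,1,2)] by (simp add: algebra_simps)
    obtain s t where st: "0 \<le> s" "s \<le> h" "0 \<le> t" "t \<le> h" and
      1: "f (x + h *\<^sub>R v + h *\<^sub>R w) - f (x + h *\<^sub>R v) - f (x + h *\<^sub>R w) + f x
        = h * h * P (x + s *\<^sub>R v + t *\<^sub>R w)"
      unfolding P_def by (rule second_difference_mean_value[OF inS f h])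
    obtain s' t' where st': "0 \<le> s'" "s' \<le> h" "0 \<le> t'" "t' \<le> h" and
      2: "f (x + h *\<^sub>R w + h *\<^sub>R v) - f (x + h *\<^sub>R w) - f (x + h *\<^sub>R v) + f x
        = h * h * Q (x + s' *\<^sub>R w + t' *\<^sub>R v)"
      unfolding Q_def by (rule second_difference_mean_value[OF inS' f h])
    have "h * h * P (x + s *\<^sub>R v + t *\<^sub>R w) = h * h * Q (x + t' *\<^sub>R v + s' *\<^sub>R w)"
      using 1 2 by (simp add: algebra_simps)
    then have "P (x + s *\<^sub>R v + t *\<^sub>R w) = Q (x + t' *\<^sub>R v + s' *\<^sub>R w)" using h by simp
    moreover have "dist (P (x + s *\<^sub>R v + t *\<^sub>R w)) (P x) < e / 2"
      using near[OF st] by (intro d) (simp add: d_def)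
    moreover have "dist (Q (x + t' *\<^sub>R v + s' *\<^sub>R w)) (Q x) < e / 2"
      using near[OF st'(3,4,1,2)] by (intro d) (simp add: d_def)
    ultimately show ?thesis unfolding dist_real_def by arith
  qed
  then have "P x = Q x" by (metis abs_zero eq_iff_diff_eq_0 less_irrefl zero_less_abs_iff)
  then show ?thesis by (simp add: P_def Q_def)
qed

lemma mixed_derivatives_commute_vector:
  fixes f :: "'a::real_normed_vector \<Rightarrow> 'b::euclidean_space"
  assumes S: "open S" and f: "smooth_on f S" and x: "x \<in> S"
  shows "frechet_derivative (\<lambda>z. frechet_derivative f (at z) v) (at x) w
       = frechet_derivative (\<lambda>z. frechet_derivative f (at z) w) (at x) v"
proof (rule euclidean_eqI)
  fix i :: 'b assume "i \<in> Basis"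
  have sm: "smooth_on (\<lambda>z. g z \<bullet> i) S" if "smooth_on g S" for g :: "'a \<Rightarrow> 'b"
    by (rule smooth_on_linear[OF bounded_linear_inner_left S that])
  have D: "frechet_derivative (\<lambda>z. g z \<bullet> i) (at z) v = frechet_derivative g (at z) v \<bullet> i"
    if "smooth_on g S" "z \<in> S" for g :: "'a \<Rightarrow> 'b" and z v
  proof -
    have "((\<lambda>z. g z \<bullet> i) has_derivative (\<lambda>v. frechet_derivative g (at z) v \<bullet> i)) (at z)"
      by (rule bounded_linear.has_derivative[OF bounded_linear_inner_left smooth_on_has_derivative[OF that]])
    from fun_cong[OF frechet_derivative_at[OF this], of v] show ?thesis by (rule sym)
  qed
  have DD: "frechet_derivative (\<lambda>z. frechet_derivative (\<lambda>z. f z \<bullet> i) (at z) v) (at x) w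
       = frechet_derivative (\<lambda>z. frechet_derivative f (at z) v) (at x) w \<bullet> i" for v w
  proof -
    have "frechet_derivative (\<lambda>z. frechet_derivative (\<lambda>z. f z \<bullet> i) (at z) v) (at x)
        = frechet_derivative (\<lambda>z. frechet_derivative f (at z) v \<bullet> i) (at x)"
    proof (rule frechet_derivative_transform_within_open[OF _ S x])
      show "(\<lambda>z. frechet_derivative (\<lambda>z. f z \<bullet> i) (at z) v) differentiable at x"
        using smooth_on_has_derivative[OF smooth_on_frechet_derivative[OF sm[OF f]] x]
        by (rule differentiableI)
    qed (use D[OF f] in auto)
    then show ?thesis
      using D[OF smooth_on_frechet_derivative[OF f] x] by simp
  qed
  show "frechet_derivative (\<lambda>z. frechet_derivative f (at z) v) (at x) w \<bullet> i
       = frechet_derivative (\<lambda>z. frechet_derivative f (at z) w) (at x) v \<bullet> i"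
    using mixed_derivatives_commute[OF S sm[OF f] x, of v w] by (simp add: DD)
qed

section \<open>Jacobians of maps of three-space\<close>

text \<open>The determinant of three columns, expanded along the first. Points are nested pairs, so
  the polynomial form makes all identities below polynomial identities in the components.\<close>

definition det3 :: "point \<Rightarrow> point \<Rightarrow> point \<Rightarrow> real"
  where "det3 a b c =
    fst a * (fst (snd b) * snd (snd c) - snd (snd b) * fst (snd c))
    - fst (snd a) * (fst b * snd (snd c) - snd (snd b) * fst c)
    + snd (snd a) * (fst b * fst (snd c) - fst (snd b) * fst c)"

definition trace3 :: "(point \<Rightarrow> point) \<Rightarrow> real"
  where "trace3 L = fst (L (1, 0, 0)) + fst (snd (L (0, 1, 0))) + snd (snd (L (0, 0, 1)))"

definition jacobian :: "(point \<Rightarrow> point) \<Rightarrow> point \<Rightarrow> real"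
  where "jacobian f x = (let A = frechet_derivative f (at x) in
    det3 (A (1, 0, 0)) (A (0, 1, 0)) (A (0, 0, 1)))"

lemma linear_triple:
  fixes A :: "point \<Rightarrow> 'a::real_vector"
  assumes "linear A"
  shows "A v = fst v *\<^sub>R A (1, 0, 0) + fst (snd v) *\<^sub>R A (0, 1, 0) + snd (snd v) *\<^sub>R A (0, 0, 1)"
proof -
  have "v = fst v *\<^sub>R (1, 0, 0) + fst (snd v) *\<^sub>R (0, 1, 0) + snd (snd v) *\<^sub>R (0, 0, 1)"
    by (simp add: prod_eq_iff)
  then have "A v = A (fst v *\<^sub>R (1, 0, 0) + fst (snd v) *\<^sub>R (0, 1, 0) + snd (snd v) *\<^sub>R (0, 0, 1))"
    by simp
  then show ?thesis by (simp only: linear_add[OF assms] linear_cmul[OF assms])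
qed

lemma det3_multilinear:
  "det3 (a + a') b c = det3 a b c + det3 a' b c" "det3 (r *\<^sub>R a) b c = r * det3 a b c"
  "det3 a (b + b') c = det3 a b c + det3 a b' c" "det3 a (r *\<^sub>R b) c = r * det3 a b c"
  "det3 a b (c + c') = det3 a b c + det3 a b c'" "det3 a b (r *\<^sub>R c) = r * det3 a b c"
  by (simp_all add: det3_def) algebra+

lemma det3_add_scaleR:
  "det3 (r *\<^sub>R a + s *\<^sub>R b + t *\<^sub>R c) b c = r * det3 a b c"
  "det3 a (r *\<^sub>R a + s *\<^sub>R b + t *\<^sub>R c) c = s * det3 a b c"
  "det3 a b (r *\<^sub>R a + s *\<^sub>R b + t *\<^sub>R c) = t * det3 a b c"
  by (simp_all add: det3_def) algebra+

text \<open>This is the first-order term in t of det((1 + tL)M) = det(1 + tL) det M. It turns a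
  linear map acting on all columns of a Jacobian matrix into a scalar factor.\<close>

lemma det3_trace3:
  assumes "linear L"
  shows "det3 (L a) b c + det3 a (L b) c + det3 a b (L c) = trace3 L * det3 a b c"
  unfolding linear_triple[OF assms, of a] linear_triple[OF assms, of b] linear_triple[OF assms, of c]
  by (simp add: det3_def trace3_def) algebra

lemma cramer3:
  "det3 v b c *\<^sub>R a + det3 a v c *\<^sub>R b + det3 a b v *\<^sub>R c = det3 a b c *\<^sub>R v"
  by (simp add: det3_def prod_eq_iff) algebra

text \<open>Cramer's rule gives the inverse as quotients of polynomials in the columns, a form from
  which smooth dependence of the inverse on the columns can be read off.\<close>

lemma linear_inverse_cramer3:
  fixes A :: "point \<Rightarrow> point"
  assumes A: "linear A" and d: "d = det3 (A (1, 0, 0)) (A (0, 1, 0)) (A (0, 0, 1))" "d \<noteq> 0"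
    and B: "\<And>v. B v = (det3 v (A (0, 1, 0)) (A (0, 0, 1)) / d,
      det3 (A (1, 0, 0)) v (A (0, 0, 1)) / d, det3 (A (1, 0, 0)) (A (0, 1, 0)) v / d)"
  shows "A \<circ> B = id" "B \<circ> A = id"
proof -
  let ?a = "A (1, 0, 0)" and ?b = "A (0, 1, 0)" and ?c = "A (0, 0, 1)"
  have "A (B v) = v" for v
  proof -
    have "A (B v) = fst (B v) *\<^sub>R ?a + fst (snd (B v)) *\<^sub>R ?b + snd (snd (B v)) *\<^sub>R ?c"
      by (rule linear_triple[OF A])
    also have "\<dots> = (1 / d) *\<^sub>R (det3 v ?b ?c *\<^sub>R ?a + det3 ?a v ?c *\<^sub>R ?b + det3 ?a ?b v *\<^sub>R ?c)"
      by (simp only: B fst_conv snd_conv scaleR_add_right scaleR_scaleR mult_1_left times_divide_eq_left)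
    also have "\<dots> = v"
      using d by (simp only: cramer3 d(1)[symmetric] scaleR_scaleR) simp
    finally show ?thesis .
  qed
  then show "A \<circ> B = id" by (simp add: fun_eq_iff)
  have "B (A v) = v" for v
  proof -
    have Av: "A v = fst v *\<^sub>R ?a + fst (snd v) *\<^sub>R ?b + snd (snd v) *\<^sub>R ?c"
      by (rule linear_triple[OF A])
    have "B (A v) = (fst v * d / d, fst (snd v) * d / d, snd (snd v) * d / d)"
      by (simp only: B Av det3_add_scaleR d(1)[symmetric])
    then show ?thesis using d(2) by simp
  qed
  then show "B \<circ> A = id" by (simp add: fun_eq_iff)
qed

lemma linear_injective3:
  fixes A :: "point \<Rightarrow> point"
  assumes A: "linear A" and "det3 (A (1, 0, 0)) (A (0, 1, 0)) (A (0, 0, 1)) \<noteq> 0" "A v = A w"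
  shows "v = w"
  using fun_cong[OF linear_inverse_cramer3(2)[OF A refl assms(2) refl], of v]
    fun_cong[OF linear_inverse_cramer3(2)[OF A refl assms(2) refl], of w] assms(3)
  by (simp only: o_apply id_apply)

lemma smooth_on_det3:
  assumes "open S" "smooth_on a S" "smooth_on b S" "smooth_on c S"
  shows "smooth_on (\<lambda>x. det3 (a x) (b x) (c x)) S"
  unfolding det3_def by (intro smooth_intros assms)

lemma smooth_on_jacobian: "open S \<Longrightarrow> smooth_on f S \<Longrightarrow> smooth_on (jacobian f) S"
  unfolding jacobian_def Let_def by (intro smooth_on_det3 smooth_on_frechet_derivative)

lemma Ck_on_det3:
  assumes S: "open S" and "Ck_on k a S" "Ck_on k b S" "Ck_on k c S"
  shows "Ck_on k (\<lambda>x. det3 (a x) (b x) (c x)) S"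
proof -
  have "Ck_on k (\<lambda>x. det3 (fst (a x, b x, c x)) (fst (snd (a x, b x, c x))) (snd (snd (a x, b x, c x)))) S"
  proof (rule Ck_on_compose[OF S open_UNIV UNIV_I, where g="\<lambda>z. det3 (fst z) (fst (snd z)) (snd (snd z))"])
    show "Ck_on k (\<lambda>z. det3 (fst z) (fst (snd z)) (snd (snd z))) UNIV"
      using smooth_on_det3[OF open_UNIV smooth_on_fst[OF open_UNIV smooth_on_ident]
          smooth_on_fst[OF open_UNIV smooth_on_snd[OF open_UNIV smooth_on_ident]]
          smooth_on_snd[OF open_UNIV smooth_on_snd[OF open_UNIV smooth_on_ident]]]
      by (simp add: smooth_on_def)
  qed (intro Ck_on_Pair assms)
  then show ?thesis by simp
qed

section \<open>The inverse function theorem in dimension three\<close>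

text \<open>Invariance of domain gives the open image, and differentiability of the inverse
  \<open>g\<close> at each point then follows from invertibility of the derivative. Smoothness is a
  bootstrap: the derivative of \<open>g\<close> is Cramer's formula evaluated at \<open>g\<close>,
  so it is as smooth as \<open>g\<close> already is.\<close>

lemma diffeo_on_jacobian:
  assumes S: "open S" and f: "smooth_on f S" and inj: "inj_on f S"
    and nz: "\<And>x. x \<in> S \<Longrightarrow> jacobian f x \<noteq> 0"
  shows "diffeo_on f S"
proof -
  define g where "g = inv_into S f"
  define V where "V = f ` S"
  define e where "e i = (if i = (0::nat) then (1, 0, 0) else if i = 1 then (0, 1, 0) else (0, 0, 1) :: point)" for i
  define D where "D i x = frechet_derivative f (at x) (e i)" for i x
  have D: "smooth_on (D i) S" for i
    unfolding D_def by (rule smooth_on_frechet_derivative[OF f])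
  have jac: "jacobian f x = det3 (D 0 x) (D 1 x) (D 2 x)" for x
    by (simp add: jacobian_def D_def e_def Let_def)
  have V: "open V"
    unfolding V_def by (rule invariance_of_domain[OF smooth_on_imp_continuous_on[OF f] S inj])
  have gf: "g (f x) = x" if "x \<in> S" for x
    using that inj by (simp add: g_def)
  have gS: "g y \<in> S" "f (g y) = y" if "y \<in> V" for y
    using that gf by (auto simp: V_def)
  define B where "B y v = (det3 v (D 1 (g y)) (D 2 (g y)) / jacobian f (g y),
      det3 (D 0 (g y)) v (D 2 (g y)) / jacobian f (g y), det3 (D 0 (g y)) (D 1 (g y)) v / jacobian f (g y))" for y v
  have dg: "(g has_derivative B y) (at y)" if y: "y \<in> V" for y
  proof -
    have df: "(f has_derivative frechet_derivative f (at (g y))) (at (g y))"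
      by (rule smooth_on_has_derivative[OF f gS(1)[OF y]])
    have "frechet_derivative f (at (g y)) \<circ> B y = id"
      by (rule linear_inverse_cramer3(1)[OF has_derivative_linear[OF df] _ nz[OF gS(1)[OF y]]])
         (simp_all add: jacobian_def Let_def B_def D_def e_def)
    from has_derivative_inverse_strong[OF S gS(1)[OF y] smooth_on_imp_continuous_on[OF f] gf df this]
    show ?thesis using gS(2)[OF y] by simp
  qed
  \<comment> \<open>The bootstrap: if \<open>g\<close> is \<open>Ck_on k\<close>, then so is every
    smooth function of \<open>g\<close>, hence \<open>B\<close>, hence \<open>g\<close> gains one
    derivative.\<close>
  have "Ck_on k g V" for k
  proof (induction k)
    case 0
    then show ?case
      using dg by (auto intro!: continuous_at_imp_continuous_on has_derivative_continuous)
  next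
    case (Suc k)
    have comp: "Ck_on k (\<lambda>y. h (g y)) V" if "smooth_on h S" for h :: "point \<Rightarrow> 'b::euclidean_space"
      by (rule Ck_on_compose[OF V S gS(1) _ Suc]) (use that in \<open>auto simp: smooth_on_def\<close>)
    have div: "Ck_on k (\<lambda>y. a y / jacobian f (g y)) V" if "Ck_on k a V" for a
      unfolding divide_inverse
      by (rule Ck_on_bilinear[OF bounded_bilinear_mult V that
            Ck_on_inverse[OF V comp[OF smooth_on_jacobian[OF S f]] nz[OF gS(1)]]])
    have "Ck_on k (\<lambda>y. B y v) V" for v
      unfolding B_def by (intro Ck_on_Pair V div Ck_on_det3 comp D Ck_on_const)
    then show ?case by (intro Ck_on_SucI[OF V dg])
  qed
  then have "smooth_on g V" by (simp add: smooth_on_def)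
  then show ?thesis using S f inj V by (simp add: diffeo_on_def g_def V_def)
qed

text \<open>Injectivity near \<open>a\<close> requires that the derivative varies continuously in
  operator norm. Smoothness gives continuity in each fixed direction, and finite dimension makes the
  two the same.\<close>

lemma local_diffeo_jacobian:
  assumes S: "open S" and f: "smooth_on f S" and a: "a \<in> S" "jacobian f a \<noteq> 0"
  obtains r where "r > 0" "ball a r \<subseteq> S" "diffeo_on f (ball a r)" "\<And>x. x \<in> ball a r \<Longrightarrow> jacobian f x \<noteq> 0"
proof -
  let ?D = "\<lambda>x. frechet_derivative f (at x)"
  define T where "T = {x \<in> S. jacobian f x \<noteq> 0}"
  have T: "open T"
  proof -
    have "T = S \<inter> jacobian f -` (- {0})" by (auto simp: T_def)
    moreover have "open (S \<inter> jacobian f -` (- {0}))"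
      by (rule continuous_open_preimage[OF smooth_on_imp_continuous_on[OF smooth_on_jacobian[OF S f]] S])
         (simp add: open_Compl)
    ultimately show ?thesis by simp
  qed
  have df: "(f has_derivative ?D x) (at x)" if "x \<in> S" for x
    by (rule smooth_on_has_derivative[OF f that])
  define B where "B v = (det3 v (?D a (0, 1, 0)) (?D a (0, 0, 1)) / jacobian f a,
      det3 (?D a (1, 0, 0)) v (?D a (0, 0, 1)) / jacobian f a,
      det3 (?D a (1, 0, 0)) (?D a (0, 1, 0)) v / jacobian f a)" for v
  have BA: "B \<circ> ?D a = id"
    by (rule linear_inverse_cramer3(2)[OF has_derivative_linear[OF df[OF a(1)]] _ a(2)])
       (simp_all add: jacobian_def Let_def B_def)
  have "linear B"
    by (rule linearI) (simp_all add: B_def det3_multilinear add_divide_distrib)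
  then have bl: "bounded_linear B" by (simp add: linear_conv_bounded_linear)
  have "\<exists>d>0. \<forall>x. dist a x < d \<longrightarrow> onorm (\<lambda>v. ?D x v - ?D a v) < e" if "e > 0" for e
  proof -
    \<comment> \<open>The sum over basis vectors dominates the operator norm of the difference, is
      continuous, and vanishes at \<open>a\<close>.\<close>
    define q where "q x = (\<Sum>i\<in>Basis. norm (?D x i - ?D a i))" for x
    have "continuous_on S q"
      unfolding q_def
      by (intro continuous_intros smooth_on_imp_continuous_on smooth_on_frechet_derivative[OF f])
    then have "isCont q a" using S a by (simp add: continuous_on_eq_continuous_at)
    then obtain d where d: "d > 0" "\<And>x. dist x a < d \<Longrightarrow> dist (q x) (q a) < e"
      unfolding continuous_at_eps_delta using \<open>e > 0\<close> by blast
    obtain d' where d': "d' > 0" "ball a d' \<subseteq> S" using S a openE by blast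
    have "onorm (\<lambda>v. ?D x v - ?D a v) < e" if "dist a x < min d d'" for x
    proof -
      have "x \<in> S" using that d' by auto
      then have "bounded_linear (\<lambda>v. ?D x v - ?D a v)"
        by (intro bounded_linear_sub has_derivative_bounded_linear[OF df] a)
      then have "onorm (\<lambda>v. ?D x v - ?D a v) \<le> q x"
        unfolding q_def by (rule onorm_componentwise)
      moreover have "q a = 0" by (simp add: q_def)
      moreover have "dist (q x) (q a) < e" using d(2)[of x] that by (simp add: dist_commute)
      ultimately show ?thesis by (simp add: dist_real_def)
    qed
    moreover have "min d d' > 0" using d d' by simp
    ultimately show ?thesis by blast
  qed
  then obtain r where r: "r > 0" "ball a r \<subseteq> S" "inj_on f (ball a r)"
    using has_derivative_locally_injective[OF a(1) S bl BA df] by blast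
  obtain r' where r': "r' > 0" "ball a r' \<subseteq> T" using openE[OF T, of a] a unfolding T_def by blast
  show thesis
  proof (rule that[of "min r r'"])
    have "ball a (min r r') \<subseteq> T" using r'(2) by auto
    then show nz: "jacobian f x \<noteq> 0" if "x \<in> ball a (min r r')" for x
      using that unfolding T_def by blast
    show sub: "ball a (min r r') \<subseteq> S" using r by auto
    show "diffeo_on f (ball a (min r r'))"
      by (rule diffeo_on_jacobian[OF open_ball smooth_on_subset[OF f sub] inj_on_subset[OF r(3)] nz]) auto
  qed (use r r' in auto)
qed

section \<open>Propagation of zeros of the Jacobian\<close>

text \<open>Gronwall's argument on the segment from \<open>a\<close> to \<open>z\<close>: the bound
  makes \<open>\<phi>\<close>, the square of \<open>d\<close> times a decaying exponential,
  nonincreasing; it starts at 0 and is nonnegative. The square avoids differentiating an absolute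
  value.\<close>

lemma gronwall_zero:
  fixes d :: "'a::real_normed_vector \<Rightarrow> real"
  assumes d: "\<And>x. x \<in> ball a r \<Longrightarrow> (d has_derivative d' x) (at x)"
    and bound: "\<And>x v. x \<in> ball a r \<Longrightarrow> \<bar>d' x v\<bar> \<le> C * norm v * \<bar>d x\<bar>"
    and a: "d a = 0" and z: "z \<in> ball a r"
  shows "d z = 0"
proof -
  define w where "w = z - a"
  define \<phi> where "\<phi> t = (d (a + t *\<^sub>R w))\<^sup>2 * exp (- 2 * C * norm w * t)" for t
  have \<phi>: "\<exists>y. DERIV \<phi> t :> y \<and> y \<le> 0" if t: "0 \<le> t" "t \<le> 1" for t
  proof -
    let ?x = "a + t *\<^sub>R w"
    have "norm (t *\<^sub>R w) \<le> norm w" using t by (simp add: mult_left_le_one_le)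
    then have x: "?x \<in> ball a r"
      using z by (simp add: w_def dist_norm norm_minus_commute)
    have 2: "((\<lambda>t. a + t *\<^sub>R w) has_derivative (\<lambda>s. s *\<^sub>R w)) (at t)"
      by (auto intro!: derivative_eq_intros)
    have "((\<lambda>t. d (a + t *\<^sub>R w)) has_derivative (\<lambda>s. d' ?x (s *\<^sub>R w))) (at t)"
      using diff_chain_at[OF 2 d[OF x]] by (simp add: o_def)
    then have 3: "((\<lambda>t. d (a + t *\<^sub>R w)) has_field_derivative d' ?x w) (at t)"
      using has_derivative_linear[OF d[OF x]]
      by (simp add: has_field_derivative_def linear_cmul mult_commute_abs)
    let ?E = "exp (- 2 * C * norm w * t)"
    let ?y = "2 * d ?x * d' ?x w * ?E - (d ?x)\<^sup>2 * (2 * C * norm w) * ?E"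
    have "DERIV \<phi> t :> ?y"
      unfolding \<phi>_def by (auto intro!: derivative_eq_intros 3 simp: algebra_simps)
    moreover have "?y \<le> 0"
    proof -
      have "d ?x * d' ?x w \<le> \<bar>d ?x\<bar> * \<bar>d' ?x w\<bar>" by (metis abs_ge_self abs_mult)
      also have "\<dots> \<le> \<bar>d ?x\<bar> * (C * norm w * \<bar>d ?x\<bar>)"
        by (intro mult_left_mono bound[OF x]) auto
      also have "\<dots> = (d ?x)\<^sup>2 * (C * norm w)" by (simp add: power2_eq_square)
      finally have "2 * d ?x * d' ?x w \<le> (d ?x)\<^sup>2 * (2 * C * norm w)" by simp
      from mult_right_mono[OF this, of ?E] show ?thesis by simp
    qed
    ultimately show ?thesis by blast
  qed
  have "\<phi> 1 \<le> \<phi> 0"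
    by (rule DERIV_nonpos_imp_nonincreasing) (use \<phi> in auto)
  then have "(d z)\<^sup>2 * exp (- 2 * C * norm w) \<le> 0" using a by (simp add: \<phi>_def w_def)
  then show ?thesis by (simp add: mult_le_0_iff)
qed

lemma has_derivative_det3:
  assumes "(a has_derivative a') (at x)" "(b has_derivative b') (at x)" "(c has_derivative c') (at x)"
  shows "((\<lambda>x. det3 (a x) (b x) (c x)) has_derivative
    (\<lambda>v. det3 (a' v) (b x) (c x) + det3 (a x) (b' v) (c x) + det3 (a x) (b x) (c' v))) (at x)"
proof -
  note c = assms[THEN has_derivative_fst] assms[THEN has_derivative_snd, THEN has_derivative_fst]
    assms[THEN has_derivative_snd, THEN has_derivative_snd]
  show ?thesis
    unfolding det3_def
    by (rule has_derivative_eq_rhs[OF has_derivative_add[OF has_derivative_diff[OF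
          has_derivative_mult[OF c(1) has_derivative_diff[OF has_derivative_mult[OF c(5) c(9)] has_derivative_mult[OF c(8) c(6)]]]
          has_derivative_mult[OF c(4) has_derivative_diff[OF has_derivative_mult[OF c(2) c(9)] has_derivative_mult[OF c(8) c(3)]]]]
          has_derivative_mult[OF c(7) has_derivative_diff[OF has_derivative_mult[OF c(2) c(6)] has_derivative_mult[OF c(5) c(3)]]]]])
       (rule ext, algebra)
qed

text \<open>Writing \<open>w\<close> in the frame and differentiating \<open>DH w = \<Sum> \<omega>\<^sub>j(w) n\<^sub>j(H)\<close> in a direction \<open>b\<close> gives, by
  symmetry of second derivatives, \<open>D\<^sub>w(DH b) = L(DH b) + DH(q)\<close> with a linear map \<open>L\<close>. So every derivative of
  the Jacobian is a continuous multiple of the Jacobian.\<close>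

lemma jacobian_zero_spreads:
  fixes H :: "point \<Rightarrow> point" and n :: "'i \<Rightarrow> point \<Rightarrow> point"
  assumes S: "open S" and H: "smooth_on H S" and x0: "x0 \<in> S" "jacobian H x0 = 0"
    and J: "finite J" and T: "open T" and HT: "\<And>x. x \<in> S \<Longrightarrow> H x \<in> T"
    and n: "\<And>j. j \<in> J \<Longrightarrow> smooth_on (n j) T"
    and e: "\<And>j. j \<in> J \<Longrightarrow> continuous_on S (e j)"
    and \<omega>: "\<And>j w. j \<in> J \<Longrightarrow> smooth_on (\<omega> j w) S"
    and frame: "\<And>j x. j \<in> J \<Longrightarrow> x \<in> S \<Longrightarrow> frechet_derivative H (at x) (e j x) = n j (H x)"
    and coframe: "\<And>x w. x \<in> S \<Longrightarrow> w = (\<Sum>j\<in>J. \<omega> j w x *\<^sub>R e j x)"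
  obtains r where "r > 0" "ball x0 r \<subseteq> S" "\<And>x. x \<in> ball x0 r \<Longrightarrow> jacobian H x = 0"
proof -
  define DH where "DH w x = frechet_derivative H (at x) w" for w x
  define Q where "Q w b x = (\<Sum>j\<in>J. frechet_derivative (\<omega> j w) (at x) b *\<^sub>R e j x)" for w b x
  define L where "L w x v = (\<Sum>j\<in>J. \<omega> j w x *\<^sub>R frechet_derivative (n j) (at (H x)) v)" for w x v
  \<comment> \<open>The logarithmic derivative of the Jacobian in direction \<open>w\<close>: the
    trace of \<open>L w x\<close>, which acts on the columns from the left, plus the trace of the
    map sending \<open>b\<close> to \<open>Q w b x\<close>, which recombines the columns from the
    right.\<close>
  define c where "c w x = trace3 (L w x) + (fst (Q w (1, 0, 0) x) + fst (snd (Q w (0, 1, 0) x))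
    + snd (snd (Q w (0, 0, 1) x)))" for w x
  have DH: "smooth_on (DH w) S" for w
    unfolding DH_def by (rule smooth_on_frechet_derivative[OF H])
  have dH: "(H has_derivative (\<lambda>w. DH w x)) (at x)" if "x \<in> S" for x
    using smooth_on_has_derivative[OF H that] by (simp add: DH_def)
  have lin: "linear (\<lambda>w. DH w x)" if "x \<in> S" for x
    using has_derivative_linear[OF dH[OF that]] .
  have dn: "(n j has_derivative frechet_derivative (n j) (at (H x))) (at (H x))" if "j \<in> J" "x \<in> S" for j x
    by (rule smooth_on_has_derivative[OF n[OF that(1)] HT[OF that(2)]])
  have linL: "linear (L w x)" if "x \<in> S" for w x
    unfolding L_def
    by (intro linear_compose_sum linear_compose_scale_right ballI has_derivative_linear[OF dn[OF _ that]])
  have DH_frame: "DH w x = (\<Sum>j\<in>J. \<omega> j w x *\<^sub>R n j (H x))" if x: "x \<in> S" for w x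
  proof -
    have "DH w x = DH (\<Sum>j\<in>J. \<omega> j w x *\<^sub>R e j x) x"
      using coframe[OF x, of w] by simp
    also have "\<dots> = (\<Sum>j\<in>J. \<omega> j w x *\<^sub>R DH (e j x) x)"
      by (simp only: linear_sum[OF lin[OF x]] linear_cmul[OF lin[OF x]])
    also have "\<dots> = (\<Sum>j\<in>J. \<omega> j w x *\<^sub>R n j (H x))"
      using frame[OF _ x] by (simp add: DH_def)
    finally show ?thesis .
  qed
  have DDH: "frechet_derivative (DH b) (at x) w = DH (Q w b x) x + L w x (DH b x)" if x: "x \<in> S" for w b x
  proof -
    have "((\<lambda>x. \<Sum>j\<in>J. \<omega> j w x *\<^sub>R n j (H x)) has_derivative
        (\<lambda>b. \<Sum>j\<in>J. \<omega> j w x *\<^sub>R frechet_derivative (n j) (at (H x)) (DH b x)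
          + frechet_derivative (\<omega> j w) (at x) b *\<^sub>R n j (H x))) (at x)"
    proof (intro has_derivative_sum has_derivative_scaleR)
      fix j assume j: "j \<in> J"
      show "(\<omega> j w has_derivative frechet_derivative (\<omega> j w) (at x)) (at x)"
        by (rule smooth_on_has_derivative[OF \<omega>[OF j] x])
      show "((\<lambda>x. n j (H x)) has_derivative (\<lambda>b. frechet_derivative (n j) (at (H x)) (DH b x))) (at x)"
        using diff_chain_at[OF dH[OF x] dn[OF j x]] by (simp add: o_def)
    qed
    then have "(DH w has_derivative
        (\<lambda>b. \<Sum>j\<in>J. \<omega> j w x *\<^sub>R frechet_derivative (n j) (at (H x)) (DH b x)
          + frechet_derivative (\<omega> j w) (at x) b *\<^sub>R n j (H x))) (at x)"
      by (rule has_derivative_transform_within_open[OF _ S x]) (simp add: DH_frame)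
    from fun_cong[OF frechet_derivative_at[OF this], of b]
    have "frechet_derivative (DH w) (at x) b = (\<Sum>j\<in>J. \<omega> j w x *\<^sub>R frechet_derivative (n j) (at (H x)) (DH b x)
          + frechet_derivative (\<omega> j w) (at x) b *\<^sub>R n j (H x))"
      by (rule sym)
    also have "\<dots> = L w x (DH b x) + (\<Sum>j\<in>J. frechet_derivative (\<omega> j w) (at x) b *\<^sub>R n j (H x))"
      by (simp add: L_def sum.distrib)
    \<comment> \<open>The frame equation is read backwards here, so that these terms become the
      value of the derivative of \<open>H\<close> on one vector. Only the coefficients
      \<open>\<omega>\<close> are differentiated, never the fields \<open>e\<close>; continuity of
      \<open>e\<close> is therefore enough.\<close>
    also have "(\<Sum>j\<in>J. frechet_derivative (\<omega> j w) (at x) b *\<^sub>R n j (H x))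
        = (\<Sum>j\<in>J. frechet_derivative (\<omega> j w) (at x) b *\<^sub>R DH (e j x) x)"
      using frame[OF _ x] by (simp add: DH_def)
    also have "\<dots> = DH (Q w b x) x"
      by (simp only: Q_def linear_sum[OF lin[OF x]] linear_cmul[OF lin[OF x]])
    finally have "frechet_derivative (DH w) (at x) b = L w x (DH b x) + DH (Q w b x) x" .
    moreover have "frechet_derivative (DH b) (at x) w = frechet_derivative (DH w) (at x) b"
      unfolding DH_def by (rule mixed_derivatives_commute_vector[OF S H x])
    ultimately show ?thesis by simp
  qed
  have jac: "jacobian H = (\<lambda>x. det3 (DH (1,0,0) x) (DH (0,1,0) x) (DH (0,0,1) x))"
    by (simp add: jacobian_def DH_def Let_def fun_eq_iff)
  have djac: "frechet_derivative (jacobian H) (at x) w = c w x * jacobian H x" if x: "x \<in> S" for w x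
  proof -
    let ?a = "DH (1,0,0) x" and ?b = "DH (0,1,0) x" and ?c = "DH (0,0,1) x"
    have Q: "DH v x = fst v *\<^sub>R ?a + fst (snd v) *\<^sub>R ?b + snd (snd v) *\<^sub>R ?c" for v
      by (rule linear_triple[OF lin[OF x]])
    note d = smooth_on_has_derivative[OF DH x]
    have "frechet_derivative (jacobian H) (at x) w
        = det3 (frechet_derivative (DH (1,0,0)) (at x) w) ?b ?c
        + det3 ?a (frechet_derivative (DH (0,1,0)) (at x) w) ?c
        + det3 ?a ?b (frechet_derivative (DH (0,0,1)) (at x) w)"
      unfolding jac using fun_cong[OF frechet_derivative_at[OF has_derivative_det3[OF d[of "(1,0,0)"] d[of "(0,1,0)"] d[of "(0,0,1)"]]], of w] by (rule sym)
    also have "\<dots> = (det3 (L w x ?a) ?b ?c + det3 ?a (L w x ?b) ?c + det3 ?a ?b (L w x ?c))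
        + (det3 (DH (Q w (1,0,0) x) x) ?b ?c + det3 ?a (DH (Q w (0,1,0) x) x) ?c + det3 ?a ?b (DH (Q w (0,0,1) x) x))"
      by (simp add: DDH[OF x] det3_multilinear)
    also have "\<dots> = c w x * jacobian H x"
      unfolding det3_trace3[OF linL[OF x]] Q[of "Q w (1,0,0) x"] Q[of "Q w (0,1,0) x"] Q[of "Q w (0,0,1) x"]
        det3_add_scaleR by (simp add: c_def jac distrib_right)
    finally show ?thesis .
  qed
  have cont: "continuous_on S (c w)" for w
  proof -
    have "continuous_on S (\<lambda>x. L w x v)" for v
      unfolding L_def
    proof (intro continuous_on_sum continuous_on_scaleR)
      fix j assume j: "j \<in> J"
      show "continuous_on S (\<omega> j w)" using \<omega>[OF j] by (rule smooth_on_imp_continuous_on)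
      show "continuous_on S (\<lambda>x. frechet_derivative (n j) (at (H x)) v)"
        using smooth_on_imp_continuous_on[OF smooth_on_compose[OF S T HT smooth_on_frechet_derivative[OF n[OF j]] H]] .
    qed
    moreover have "continuous_on S (\<lambda>x. Q w v x)" for v
      unfolding Q_def
      by (intro continuous_on_sum continuous_on_scaleR e smooth_on_imp_continuous_on[OF smooth_on_frechet_derivative[OF \<omega>]])
    ultimately show ?thesis
      unfolding c_def trace3_def by (intro continuous_intros)
  qed
  \<comment> \<open>A continuous bound for the three factors along the axes. On a small ball it is
    at most \<open>C x0 + 1\<close>, which is the constant for \<open>gronwall_zero\<close>.\<close>
  define C where "C x = \<bar>c (1,0,0) x\<bar> + \<bar>c (0,1,0) x\<bar> + \<bar>c (0,0,1) x\<bar>" for x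
  have "continuous_on S C" unfolding C_def by (intro continuous_intros cont)
  then have "isCont C x0" using S x0 by (simp add: continuous_on_eq_continuous_at)
  then obtain r1 where r1: "r1 > 0" "\<And>x. dist x x0 < r1 \<Longrightarrow> dist (C x) (C x0) < 1"
    unfolding continuous_at_eps_delta by (metis zero_less_one)
  obtain r2 where r2: "r2 > 0" "ball x0 r2 \<subseteq> S" using openE[OF S x0(1)] by blast
  define r where "r = min r1 r2"
  have sub: "ball x0 r \<subseteq> S" using r2 by (auto simp: r_def)
  have dj: "(jacobian H has_derivative frechet_derivative (jacobian H) (at x)) (at x)" if "x \<in> S" for x
    by (rule smooth_on_has_derivative[OF smooth_on_jacobian[OF S H] that])
  have bound: "\<bar>frechet_derivative (jacobian H) (at x) v\<bar> \<le> (C x0 + 1) * norm v * \<bar>jacobian H x\<bar>"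
    if x: "x \<in> ball x0 r" for x v
  proof -
    have xS: "x \<in> S" using sub x by blast
    have Cx: "C x \<le> C x0 + 1"
      using r1(2)[of x] x by (simp add: r_def dist_commute dist_real_def)
    have n1: "\<bar>fst v\<bar> \<le> norm v" using norm_fst_le[of "fst v" "snd v"] by simp
    have n2: "norm (snd v) \<le> norm v" using norm_snd_le[of "snd v" "fst v"] by simp
    have n3: "\<bar>fst (snd v)\<bar> \<le> norm v" using norm_fst_le[of "fst (snd v)" "snd (snd v)"] n2 by simp
    have n4: "\<bar>snd (snd v)\<bar> \<le> norm v" using norm_snd_le[of "snd (snd v)" "fst (snd v)"] n2 by simp
    let ?k = "fst v * c (1,0,0) x + fst (snd v) * c (0,1,0) x + snd (snd v) * c (0,0,1) x"
    have "frechet_derivative (jacobian H) (at x) v = ?k * jacobian H x"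
      unfolding linear_triple[OF has_derivative_linear[OF dj[OF xS]], of v]
      by (simp add: djac[OF xS] algebra_simps)
    moreover have "\<bar>?k\<bar> \<le> norm v * C x"
    proof -
      have "\<bar>?k\<bar> \<le> \<bar>fst v\<bar> * \<bar>c (1,0,0) x\<bar> + \<bar>fst (snd v)\<bar> * \<bar>c (0,1,0) x\<bar> + \<bar>snd (snd v)\<bar> * \<bar>c (0,0,1) x\<bar>"
        unfolding abs_mult[symmetric] by arith
      also have "\<dots> \<le> norm v * \<bar>c (1,0,0) x\<bar> + norm v * \<bar>c (0,1,0) x\<bar> + norm v * \<bar>c (0,0,1) x\<bar>"
        by (intro add_mono mult_right_mono n1 n3 n4) auto
      finally show ?thesis by (simp add: C_def distrib_left)
    qed
    moreover have "norm v * C x \<le> (C x0 + 1) * norm v"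
      using mult_left_mono[OF Cx, of "norm v"] by (simp add: mult.commute)
    ultimately show ?thesis
      by (simp add: abs_mult mult_right_mono)
  qed
  show thesis
  proof (rule that[OF _ sub])
    show "r > 0" using r1 r2 by (simp add: r_def)
    show "jacobian H x = 0" if "x \<in> ball x0 r" for x
      by (rule gronwall_zero[OF dj[OF subsetD[OF sub]] bound x0(2) that])
  qed
qed

section \<open>Images of critical points\<close>

definition vec3 :: "point \<Rightarrow> real^3" where "vec3 v = vector [fst v, fst (snd v), snd (snd v)]"

definition unvec3 :: "real^3 \<Rightarrow> point" where "unvec3 v = (v $ 1, v $ 2, v $ 3)"

lemma vec3_inverse [simp]: "unvec3 (vec3 v) = v" "vec3 (unvec3 w) = w"
  by (simp_all add: vec3_def unvec3_def vec_eq_iff forall_3)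

lemma bounded_linear_vec3: "bounded_linear vec3" "bounded_linear unvec3"
  unfolding linear_conv_bounded_linear[symmetric]
  by (auto intro!: linearI simp: vec3_def unvec3_def vec_eq_iff forall_3)

text \<open>Sard's theorem, transferred from \<open>real ^ 3\<close>.\<close>

lemma critical_image_has_empty_interior:
  fixes H :: "point \<Rightarrow> point"
  assumes S: "open S" and H: "smooth_on H S" and crit: "\<And>x. x \<in> S \<Longrightarrow> jacobian H x = 0"
    and U: "open U" "U \<subseteq> H ` S"
  shows "U = {}"
proof -
  define h where "h = vec3 \<circ> H \<circ> unvec3"
  define h' where "h' v = vec3 \<circ> frechet_derivative H (at (unvec3 v)) \<circ> unvec3" for v
  have dh: "(h has_derivative h' v) (at v)" if "v \<in> vec3 ` S" for v
  proof -
    have "unvec3 v \<in> S" using that by auto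
    note 1 = smooth_on_has_derivative[OF H this]
    show ?thesis
      unfolding h_def h'_def
      by (intro diff_chain_at bounded_linear_imp_has_derivative bounded_linear_vec3 1)
  qed
  have "negligible (h ` (vec3 ` S))"
  proof (rule baby_Sard)
    fix v assume v: "v \<in> vec3 ` S"
    show "(h has_derivative h' v) (at v within vec3 ` S)"
      by (rule has_derivative_at_withinI[OF dh[OF v]])
    have "det (matrix (h' v)) = jacobian H (unvec3 v)"
    proof -
      have ax: "unvec3 (axis 1 1) = (1,0,0)" "unvec3 (axis 2 1) = (0,1,0)" "unvec3 (axis 3 1) = (0,0,1)"
        by (simp_all add: unvec3_def axis_def)
      define A where "A = frechet_derivative H (at (unvec3 v))"
      have M: "matrix (h' v) = (\<chi> i j. vec3 (A (unvec3 (axis j 1))) $ i)"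
        by (simp add: matrix_def h'_def A_def)
      have V: "vec3 w $ 1 = fst w" "vec3 w $ 2 = fst (snd w)" "vec3 w $ 3 = snd (snd w)" for w
        by (simp_all add: vec3_def)
      show ?thesis
        unfolding jacobian_def Let_def det3_def A_def[symmetric] det_3 M
        by (simp only: vec_lambda_beta ax V) algebra
    qed
    also have "\<dots> = 0" using v crit by auto
    finally have "rank (matrix (h' v)) \<noteq> CARD(3)" by (simp add: det_eq_0_rank)
    then show "rank (matrix (h' v)) < CARD(3)"
      using rank_bound[of "matrix (h' v)"] by simp
  qed simp
  moreover have "h ` (vec3 ` S) = vec3 ` (H ` S)" by (simp add: h_def image_image)
  ultimately have "negligible (vec3 ` U)"
    using U(2) by (metis image_mono negligible_subset)
  moreover have "open (vec3 ` U)"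
  proof -
    have "w \<in> vec3 ` U" if "unvec3 w \<in> U" for w
      using imageI[OF that, of vec3] by simp
    then have "vec3 ` U = unvec3 -` U" by auto
    then show ?thesis
      using open_vimage[OF U(1), of unvec3] linear_continuous_on[OF bounded_linear_vec3(2), of UNIV] by simp
  qed
  ultimately have "vec3 ` U = {}" using open_not_negligible by blast
  then show ?thesis by simp
qed

section \<open>The invariant frame\<close>

text \<open>The partial derivatives are defined by \<open>deriv\<close> on coordinate lines. The
  chain rule along these lines reads them off from any total derivative, so later partials are
  computed by differentiating once in all variables.\<close>

lemma D_has_derivative:
  assumes "(h has_derivative h') (at x)"
  shows "D_u h x = h' (1, 0, 0)" "D_y h x = h' (0, 1, 0)" "D_p h x = h' (0, 0, 1)"
proof -
  obtain u y p where x: "x = (u, y, p)" by (cases x)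
  have lin: "linear h'" using assms by (rule has_derivative_linear)
  have *: "deriv (\<lambda>s. h (c s)) t = h' w"
    if c: "c t = x" "(c has_derivative (\<lambda>s. s *\<^sub>R w)) (at t)" for c :: "real \<Rightarrow> point" and t w
  proof (rule DERIV_imp_deriv)
    have "((\<lambda>s. h (c s)) has_derivative (\<lambda>s. h' (s *\<^sub>R w))) (at t)"
      using diff_chain_at[OF c(2), of h h'] assms c(1) by (simp add: o_def)
    then show "((\<lambda>s. h (c s)) has_field_derivative h' w) (at t)"
      by (simp add: has_field_derivative_def linear_cmul[OF lin] mult_commute_abs)
  qed
  show "D_u h x = h' (1, 0, 0)"
    unfolding x D_u_def prod.case by (rule *) (auto simp: x zero_prod_def intro!: derivative_eq_intros)
  show "D_y h x = h' (0, 1, 0)"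
    unfolding x D_y_def prod.case by (rule *) (auto simp: x zero_prod_def intro!: derivative_eq_intros)
  show "D_p h x = h' (0, 0, 1)"
    unfolding x D_p_def prod.case by (rule *) (auto simp: x zero_prod_def intro!: derivative_eq_intros)
qed

lemma D_eq_frechet_derivative:
  assumes "smooth_on h S" "x \<in> S"
  shows "D_u h x = frechet_derivative h (at x) (1, 0, 0)" "D_y h x = frechet_derivative h (at x) (0, 1, 0)"
    "D_p h x = frechet_derivative h (at x) (0, 0, 1)"
  using D_has_derivative[OF smooth_on_has_derivative[OF assms]] .

lemma frechet_derivative_eq_D:
  assumes "smooth_on h S" "x \<in> S"
  shows "frechet_derivative h (at x) w = fst w * D_u h x + fst (snd w) * D_y h x + snd (snd w) * D_p h x"
  unfolding D_eq_frechet_derivative[OF assms]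
  using linear_triple[OF has_derivative_linear[OF smooth_on_has_derivative[OF assms]], of w] by simp

lemma has_derivative_D:
  assumes "smooth_on h S" "x \<in> S"
  shows "(h has_derivative (\<lambda>w. fst w * D_u h x + fst (snd w) * D_y h x + snd (snd w) * D_p h x)) (at x)"
  using smooth_on_has_derivative[OF assms] frechet_derivative_eq_D[OF assms]
  by (metis (no_types, lifting) ext)

lemma smooth_on_D:
  assumes "open S" "smooth_on h S"
  shows "smooth_on (D_u h) S" "smooth_on (D_y h) S" "smooth_on (D_p h) S"
proof -
  note s = smooth_on_frechet_derivative[OF assms(2)]
  show "smooth_on (D_u h) S"
    using s[of "(1, 0, 0)"] smooth_on_cong[OF assms(1), of "D_u h" "\<lambda>x. frechet_derivative h (at x) (1, 0, 0)"]
      D_eq_frechet_derivative(1)[OF assms(2)] by simp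
  show "smooth_on (D_y h) S"
    using s[of "(0, 1, 0)"] smooth_on_cong[OF assms(1), of "D_y h" "\<lambda>x. frechet_derivative h (at x) (0, 1, 0)"]
      D_eq_frechet_derivative(2)[OF assms(2)] by simp
  show "smooth_on (D_p h) S"
    using s[of "(0, 0, 1)"] smooth_on_cong[OF assms(1), of "D_p h" "\<lambda>x. frechet_derivative h (at x) (0, 0, 1)"]
      D_eq_frechet_derivative(3)[OF assms(2)] by simp
qed

lemma D_commute:
  assumes S: "open S" and h: "smooth_on h S" and x: "x \<in> S"
  shows "D_p (D_y h) x = D_y (D_p h) x" "D_p (D_u h) x = D_u (D_p h) x" "D_y (D_u h) x = D_u (D_y h) x"
proof -
  have DD: "frechet_derivative (\<lambda>z. frechet_derivative h (at z) v) (at x) w = frechet_derivative k (at x) w"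
    if "\<And>z. z \<in> S \<Longrightarrow> k z = frechet_derivative h (at z) v" for k v w
  proof -
    have "frechet_derivative (\<lambda>z. frechet_derivative h (at z) v) (at x) = frechet_derivative k (at x)"
      by (rule frechet_derivative_transform_within_open[OF
            differentiableI[OF smooth_on_has_derivative[OF smooth_on_frechet_derivative[OF h] x]] S x])
         (simp add: that)
    then show ?thesis by simp
  qed
  note s = smooth_on_D[OF S h] and D = D_eq_frechet_derivative[OF h]
  note e = D_eq_frechet_derivative[OF s(1) x] D_eq_frechet_derivative[OF s(2) x] D_eq_frechet_derivative[OF s(3) x]
  note c = mixed_derivatives_commute[OF S h x]
  have DD_uyp:
    "frechet_derivative (\<lambda>z. frechet_derivative h (at z) (1,0,0)) (at x) w = frechet_derivative (D_u h) (at x) w"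
    "frechet_derivative (\<lambda>z. frechet_derivative h (at z) (0,1,0)) (at x) w = frechet_derivative (D_y h) (at x) w"
    "frechet_derivative (\<lambda>z. frechet_derivative h (at z) (0,0,1)) (at x) w = frechet_derivative (D_p h) (at x) w"
    for w
    by (rule DD, erule D)+
  show "D_p (D_y h) x = D_y (D_p h) x"
    unfolding e using c[of "(0,1,0)" "(0,0,1)"] by (simp only: DD_uyp)
  show "D_p (D_u h) x = D_u (D_p h) x"
    unfolding e using c[of "(1,0,0)" "(0,0,1)"] by (simp only: DD_uyp)
  show "D_y (D_u h) x = D_u (D_y h) x"
    unfolding e using c[of "(1,0,0)" "(0,1,0)"] by (simp only: DD_uyp)
qed

section \<open>The third derivation and the identities between the invariants\<close>

text \<open>Differentiation along the trajectories y' = p, p' = F with \<open>u\<close> held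
  fixed.\<close>

definition D_t :: "scalar \<Rightarrow> scalar \<Rightarrow> scalar"
  where "D_t F h x = snd (snd x) * D_y h x + F x * D_p h x"

text \<open>The total derivative along the system is not invariant, because nothing fixes the velocity of
  \<open>u\<close>. Requiring that \<open>inv_J\<close> is constant fixes it.\<close>

definition nabla_y :: "scalar \<Rightarrow> scalar \<Rightarrow> scalar"
  where "nabla_y F h x = D_t F h x - D_t F (inv_J F) x / inv_Ju F x * nabla_u F h x"

lemma nabla_simps:
  "nabla_u F h x = snd (snd x) / D_u F x * D_u h x"
  "nabla_p h x = snd (snd x) * D_p h x"
  "inv_J F x = (snd (snd x) * D_p F x - 2 * F x) / snd (snd x)"
  by (cases x; simp add: nabla_u_def nabla_p_def inv_J_def)+

lemmas inv_defs = inv_Ju_def inv_Jp_def inv_Juu_def inv_Jup_def inv_Jpu_def inv_Jpp_def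

text \<open>Condition (1) of regularity on an open set. The identities between the invariants and
  the invariance of \<open>\<sigma>\<close> are pointwise matters that rest on this alone; the shape
  of the image enters later.\<close>

locale nondegenerate_system =
  fixes F :: scalar and S :: "point set"
  assumes S: "open S" and F: "smooth_on F S"
    and p_nz: "x \<in> S \<Longrightarrow> snd (snd x) \<noteq> 0"
    and Fu_nz: "x \<in> S \<Longrightarrow> D_u F x \<noteq> 0"
    and Ju_nz: "x \<in> S \<Longrightarrow> inv_Ju F x \<noteq> 0"
begin

lemma smooth_nabla:
  assumes "smooth_on h S"
  shows "smooth_on (nabla_u F h) S" "smooth_on (nabla_p h) S"
  unfolding nabla_simps[abs_def]
  by (intro smooth_intros smooth_on_D S F assms; simp add: Fu_nz)+

lemma smooth_J: "smooth_on (inv_J F) S"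
  unfolding nabla_simps[abs_def]
  by (intro smooth_intros smooth_on_D S F; simp add: p_nz)

lemma smooth_invs:
  "smooth_on (inv_Ju F) S" "smooth_on (inv_Jp F) S" "smooth_on (inv_Juu F) S" "smooth_on (inv_Jup F) S"
  "smooth_on (inv_Jpu F) S" "smooth_on (inv_Jpp F) S"
  unfolding inv_defs by (intro smooth_nabla smooth_J)+

lemma smooth_D_t: "smooth_on h S \<Longrightarrow> smooth_on (D_t F h) S"
  unfolding D_t_def[abs_def] by (intro smooth_intros smooth_on_D S F)

lemma smooth_nabla_y: "smooth_on h S \<Longrightarrow> smooth_on (nabla_y F h) S"
  unfolding nabla_y_def[abs_def]
  by (intro smooth_intros smooth_D_t smooth_nabla smooth_J smooth_invs S) (auto simp: Ju_nz)

lemma J_eq: "x \<in> S \<Longrightarrow> inv_J F x = D_p F x - 2 * F x / snd (snd x)"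
  using p_nz by (simp add: nabla_simps diff_divide_distrib)

lemma D_cong:
  assumes "x \<in> S" "\<And>z. z \<in> S \<Longrightarrow> h z = k z" "(k has_derivative k') (at x)"
  shows "D_u h x = k' (1, 0, 0)" "D_y h x = k' (0, 1, 0)" "D_p h x = k' (0, 0, 1)"
  using D_has_derivative[OF has_derivative_transform_within_open[OF assms(3) S assms(1), of h]] assms(2)
  by auto

lemma D_J:
  assumes x: "x \<in> S"
  shows "D_u (inv_J F) x = D_u (D_p F) x - 2 * D_u F x / snd (snd x)"
    "D_y (inv_J F) x = D_y (D_p F) x - 2 * D_y F x / snd (snd x)"
    "D_p (inv_J F) x = D_p (D_p F) x - 2 * D_p F x / snd (snd x) + 2 * F x / (snd (snd x))\<^sup>2"
proof -
  note d = has_derivative_D[OF F x] has_derivative_D[OF smooth_on_D(3)[OF S F] x]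
  have "((\<lambda>x. D_p F x - 2 * F x / snd (snd x)) has_derivative
    (\<lambda>w. (fst w * D_u (D_p F) x + fst (snd w) * D_y (D_p F) x + snd (snd w) * D_p (D_p F) x)
      - (2 * (fst w * D_u F x + fst (snd w) * D_y F x + snd (snd w) * D_p F x) / snd (snd x)
        - 2 * F x * snd (snd w) / (snd (snd x))\<^sup>2))) (at x)"
    using p_nz[OF x]
    by (auto intro!: derivative_eq_intros d simp: fun_eq_iff field_simps power2_eq_square)
  from D_cong[OF x J_eq this]
  show "D_u (inv_J F) x = D_u (D_p F) x - 2 * D_u F x / snd (snd x)"
    "D_y (inv_J F) x = D_y (D_p F) x - 2 * D_y F x / snd (snd x)"
    "D_p (inv_J F) x = D_p (D_p F) x - 2 * D_p F x / snd (snd x) + 2 * F x / (snd (snd x))\<^sup>2"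
    by simp_all
qed

lemma Ju_eq: "x \<in> S \<Longrightarrow> inv_Ju F x = snd (snd x) * D_u (D_p F) x / D_u F x - 2"
  using p_nz Fu_nz by (simp add: inv_Ju_def nabla_simps(1) D_J field_simps)

lemma Jp_eq:
  "x \<in> S \<Longrightarrow> inv_Jp F x = snd (snd x) * D_p (D_p F) x - 2 * D_p F x + 2 * F x / snd (snd x)"
  using p_nz by (simp add: inv_Jp_def nabla_simps(2) D_J field_simps power2_eq_square)

text \<open>The commutator of \<open>nabla_u\<close> and \<open>nabla_p\<close> is
  \<open>1 + inv_Ju F\<close> times \<open>nabla_u\<close>: differentiating the coefficient p / F_u
  of \<open>nabla_u\<close> produces p F_up / F_u, which equals \<open>inv_Ju F + 2\<close> by
  \<open>Ju_eq\<close>. The identity is this commutator applied to \<open>inv_J F\<close>.\<close>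

lemma Jup_eq:
  assumes x: "x \<in> S"
  shows "inv_Jup F x = inv_Jpu F x + (1 + inv_Ju F x) * inv_Ju F x"
proof -
  note d = has_derivative_D[OF smooth_on_D(1)[OF S F] x] has_derivative_D[OF smooth_on_D(1)[OF S smooth_J] x]
    has_derivative_D[OF smooth_on_D(3)[OF S smooth_J] x]
  let ?p = "snd (snd x)"
  have "((\<lambda>x. snd (snd x) / D_u F x * D_u (inv_J F) x) has_derivative
    (\<lambda>w. (snd (snd w) / D_u F x
        - ?p * (fst w * D_u (D_u F) x + fst (snd w) * D_y (D_u F) x + snd (snd w) * D_p (D_u F) x) / (D_u F x)\<^sup>2)
       * D_u (inv_J F) x
      + ?p / D_u F x * (fst w * D_u (D_u (inv_J F)) x + fst (snd w) * D_y (D_u (inv_J F)) x + snd (snd w) * D_p (D_u (inv_J F)) x))) (at x)"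
    using Fu_nz[OF x]
    by (auto intro!: derivative_eq_intros d simp: fun_eq_iff field_simps power2_eq_square)
  from D_cong(3)[OF x _ this, of "nabla_u F (inv_J F)"]
  have 1: "D_p (nabla_u F (inv_J F)) x = (1 / D_u F x - ?p * D_p (D_u F) x / (D_u F x)\<^sup>2) * D_u (inv_J F) x
      + ?p / D_u F x * D_p (D_u (inv_J F)) x"
    by (simp add: nabla_simps)
  have "((\<lambda>x. snd (snd x) * D_p (inv_J F) x) has_derivative
    (\<lambda>w. snd (snd w) * D_p (inv_J F) x
      + ?p * (fst w * D_u (D_p (inv_J F)) x + fst (snd w) * D_y (D_p (inv_J F)) x + snd (snd w) * D_p (D_p (inv_J F)) x))) (at x)"
    by (auto intro!: derivative_eq_intros d simp: fun_eq_iff algebra_simps)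
  from D_cong(1)[OF x _ this, of "nabla_p (inv_J F)"]
  have 2: "D_u (nabla_p (inv_J F)) x = ?p * D_u (D_p (inv_J F)) x"
    by (simp add: nabla_simps)
  have 3: "inv_Jpu F x = ?p * ((1 / D_u F x - ?p * D_p (D_u F) x / (D_u F x)\<^sup>2) * D_u (inv_J F) x
      + ?p / D_u F x * D_p (D_u (inv_J F)) x)"
    by (simp add: inv_Jpu_def nabla_simps(2) 1)
  have 4: "inv_Jup F x = ?p / D_u F x * (?p * D_p (D_u (inv_J F)) x)"
    by (simp only: inv_Jup_def nabla_simps(1) 2 D_commute[OF S smooth_J x])
  have 5: "D_u (inv_J F) x = inv_Ju F x * D_u F x / ?p"
    using p_nz[OF x] Fu_nz[OF x] by (simp add: inv_Ju_def nabla_simps(1))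
  have 6: "D_p (D_u F) x = (inv_Ju F x + 2) * D_u F x / ?p"
    using p_nz[OF x] Fu_nz[OF x] by (simp add: Ju_eq[OF x] D_commute[OF S F x])
  show ?thesis
    unfolding 3 4 5 6 using p_nz[OF x] Fu_nz[OF x] by (simp add: field_simps power2_eq_square)
qed

lemma nabla_y_J: "x \<in> S \<Longrightarrow> nabla_y F (inv_J F) x = 0"
  using Ju_nz by (simp add: nabla_y_def inv_Ju_def)

lemma D_y_Jp:
  assumes x: "x \<in> S"
  shows "D_y (inv_Jp F) x = snd (snd x) * D_y (D_p (D_p F)) x - 2 * D_y (D_p F) x + 2 * D_y F x / snd (snd x)"
proof -
  note s = smooth_on_D(3)[OF S F]
  note d = has_derivative_D[OF F x] has_derivative_D[OF s x] has_derivative_D[OF smooth_on_D(3)[OF S s] x]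
  let ?p = "snd (snd x)"
  have "((\<lambda>x. snd (snd x) * D_p (D_p F) x - 2 * D_p F x + 2 * F x / snd (snd x)) has_derivative
    (\<lambda>w. snd (snd w) * D_p (D_p F) x
      + ?p * (fst w * D_u (D_p (D_p F)) x + fst (snd w) * D_y (D_p (D_p F)) x + snd (snd w) * D_p (D_p (D_p F)) x)
      - 2 * (fst w * D_u (D_p F) x + fst (snd w) * D_y (D_p F) x + snd (snd w) * D_p (D_p F) x)
      + (2 * (fst w * D_u F x + fst (snd w) * D_y F x + snd (snd w) * D_p F x) / ?p
        - 2 * F x * snd (snd w) / ?p\<^sup>2))) (at x)"
    using p_nz[OF x]
    by (auto intro!: derivative_eq_intros d simp: fun_eq_iff field_simps power2_eq_square)
  from D_cong(2)[OF x Jp_eq this] show ?thesis by simp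
qed

lemma D_y_Ju:
  assumes x: "x \<in> S"
  shows "D_y (inv_Ju F) x = snd (snd x) * D_y (D_u (D_p F)) x / D_u F x - (2 + inv_Ju F x) * D_y (D_u F) x / D_u F x"
proof -
  note s = smooth_on_D(1)[OF S F] smooth_on_D(1)[OF S smooth_on_D(3)[OF S F]]
  note d = has_derivative_D[OF s(1) x] has_derivative_D[OF s(2) x]
  let ?p = "snd (snd x)"
  have "((\<lambda>x. snd (snd x) * D_u (D_p F) x / D_u F x - 2) has_derivative
    (\<lambda>w. (snd (snd w) * D_u (D_p F) x
      + ?p * (fst w * D_u (D_u (D_p F)) x + fst (snd w) * D_y (D_u (D_p F)) x + snd (snd w) * D_p (D_u (D_p F)) x)) / D_u F x
      - ?p * D_u (D_p F) x * (fst w * D_u (D_u F) x + fst (snd w) * D_y (D_u F) x + snd (snd w) * D_p (D_u F) x) / (D_u F x)\<^sup>2)) (at x)"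
    using Fu_nz[OF x]
    by (auto intro!: derivative_eq_intros d simp: fun_eq_iff field_simps power2_eq_square)
  from D_cong(2)[OF x Ju_eq this]
  have "D_y (inv_Ju F) x = ?p * D_y (D_u (D_p F)) x / D_u F x - ?p * D_u (D_p F) x * D_y (D_u F) x / (D_u F x)\<^sup>2"
    by simp
  then show ?thesis
    using Fu_nz[OF x] by (simp add: Ju_eq[OF x] field_simps power2_eq_square)
qed

text \<open>The long formula of \<open>inv_K\<close> is the derivative of \<open>inv_Jp F\<close>
  along the third field written out in jets, plus its last summand, a function of the other
  invariants. The correction in \<open>nabla_y\<close> brings in \<open>inv_Jup F\<close>, and the
  commutator identity trades it for the \<open>inv_Jpu F\<close> of the formula.\<close>

lemma K_eq:
  assumes x: "x \<in> S"
  shows "inv_K F x = nabla_y F (inv_Jp F) x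
    + (inv_Ju F x - inv_Jp F x) * (inv_Jpp F x + inv_Jp F x) / inv_Ju F x"
proof -
  let ?p = "snd (snd x)"
  note s = smooth_on_D(3)[OF S F] smooth_on_D(2)[OF S F]
  have c: "D_p (D_y F) x = D_y (D_p F) x" by (rule D_commute(1)[OF S F x])
  \<comment> \<open>Third derivatives are reordered in two swaps. The inner swap must hold on the
    whole open set before it can be differentiated once more.\<close>
  have "frechet_derivative (D_p (D_y F)) (at x) = frechet_derivative (D_y (D_p F)) (at x)"
    using smooth_on_has_derivative[OF smooth_on_D(3)[OF S s(2)] x] D_commute(1)[OF S F]
    by (intro frechet_derivative_transform_within_open[OF _ S x]) (auto intro: differentiableI)
  then have "D_p (D_p (D_y F)) x = D_p (D_y (D_p F)) x"
    by (simp add: D_eq_frechet_derivative[OF smooth_on_D(3)[OF S s(2)] x]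
        D_eq_frechet_derivative[OF smooth_on_D(2)[OF S s(1)] x])
  then have cc: "D_p (D_p (D_y F)) x = D_y (D_p (D_p F)) x"
    by (simp only: D_commute(1)[OF S s(1) x])
  have 1: "?p * D_p (inv_Jp F) x = inv_Jpp F x" "nabla_u F (inv_Jp F) x = inv_Jup F x"
    by (simp_all add: inv_defs nabla_simps(2))
  have 2: "D_p (inv_J F) x = inv_Jp F x / ?p" "D_p (inv_Jp F) x = inv_Jpp F x / ?p"
    using p_nz[OF x] by (simp_all add: inv_defs nabla_simps(2))
  have eq: "inv_K F x = ?p\<^sup>2 * D_y (D_p (D_p F)) x - (3 * ?p * inv_Ju F x + ?p * inv_Jpu F x) / inv_Ju F x * D_y (D_p F) x
      - ?p * inv_Ju F x * D_y (D_p F) x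
       + 2 * (inv_Jpu F x + 2 * inv_Ju F x) / inv_Ju F x * D_y F x + 2 * inv_Ju F x * D_y F x
       - ((inv_Ju F x * inv_Jp F x + inv_Jp F x - inv_Jpp F x) * inv_Ju F x + inv_Jp F x * inv_Jpu F x) / (?p * inv_Ju F x) * F x
       + (inv_Ju F x - inv_Jp F x) * (inv_Jpp F x + inv_Jp F x) / inv_Ju F x"
    using c cc by (cases x) (simp add: inv_K_def Let_def)
  show ?thesis
    unfolding eq nabla_y_def D_t_def 1 2 D_y_Jp[OF x] D_J(2)[OF x] Jup_eq[OF x]
    using p_nz[OF x] Ju_nz[OF x] by (simp add: field_simps power2_eq_square)
qed

text \<open>The analogue for \<open>inv_Ju F\<close>. Here the correction in \<open>nabla_y\<close>
  brings in \<open>inv_Juu F\<close>, so no commutator intervenes.\<close>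

lemma L_eq:
  assumes x: "x \<in> S"
  shows "inv_L F x = nabla_y F (inv_Ju F) x + inv_Jp F x + inv_Jpp F x"
proof -
  let ?p = "snd (snd x)"
  note s = smooth_on_D(3)[OF S F] smooth_on_D(1)[OF S F]
  have c: "D_p (D_y F) x = D_y (D_p F) x" by (rule D_commute(1)[OF S F x])
  have "frechet_derivative (D_p (D_u F)) (at x) = frechet_derivative (D_u (D_p F)) (at x)"
    using smooth_on_has_derivative[OF smooth_on_D(3)[OF S s(2)] x] D_commute(2)[OF S F]
    by (intro frechet_derivative_transform_within_open[OF _ S x]) (auto intro: differentiableI)
  then have "D_y (D_p (D_u F)) x = D_y (D_u (D_p F)) x"
    by (simp add: D_eq_frechet_derivative[OF smooth_on_D(3)[OF S s(2)] x]
        D_eq_frechet_derivative[OF smooth_on_D(1)[OF S s(1)] x])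
  then have cc: "D_p (D_y (D_u F)) x = D_y (D_u (D_p F)) x"
    by (simp only: D_commute(1)[OF S s(2) x])
  have 2: "nabla_u F (inv_Ju F) x = inv_Juu F x"
    "D_p (inv_J F) x = inv_Jp F x / ?p" "D_p (inv_Ju F) x = inv_Jpu F x / ?p"
    using p_nz[OF x] by (simp_all add: inv_defs nabla_simps(2))
  have eq: "inv_L F x = ?p\<^sup>2 / D_u F x * D_y (D_u (D_p F)) x - (2 + inv_Ju F x) * ?p / D_u F x * D_y (D_u F) x
      - ?p * inv_Juu F x / inv_Ju F x * D_y (D_p F) x
       + 2 * (inv_Juu F x / inv_Ju F x) * D_y F x + (inv_Jpu F x / ?p - inv_Jp F x * inv_Juu F x / (?p * inv_Ju F x)) * F x
       + inv_Jp F x + inv_Jpp F x"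
    using c cc by (cases x) (simp add: inv_L_def Let_def)
  show ?thesis
    unfolding eq nabla_y_def D_t_def 2 D_y_Ju[OF x] D_J(2)[OF x]
    using p_nz[OF x] Ju_nz[OF x] Fu_nz[OF x] by (simp add: field_simps power2_eq_square)
qed

end

section \<open>The frame as vector fields\<close>

definition inv_H :: "scalar \<Rightarrow> point \<Rightarrow> point"
  where "inv_H F x = (inv_J F x, inv_Ju F x, inv_Jp F x)"

text \<open>Component vectors of the derivations \<open>nabla_u\<close>, \<open>nabla_y\<close>,
  \<open>nabla_p\<close> in the order (u, y, p). All indices above 1 stand for the last field, so
  identities hold for every \<open>i\<close> without a range condition.\<close>

definition frame :: "scalar \<Rightarrow> nat \<Rightarrow> point \<Rightarrow> point"
  where "frame F i x =
    (if i = 0 then (snd (snd x) / D_u F x, 0, 0)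
     else if i = 1 then (- (D_t F (inv_J F) x / inv_Ju F x * (snd (snd x) / D_u F x)), snd (snd x), F x)
     else (0, 0, snd (snd x)))"

text \<open>The dual basis: \<open>coframe F i w x\<close> is the coefficient of
  \<open>frame F i x\<close> in the expansion of the constant vector \<open>w\<close>.\<close>

definition coframe :: "scalar \<Rightarrow> nat \<Rightarrow> point \<Rightarrow> scalar"
  where "coframe F i w x =
    (if i = 0 then (fst w + D_t F (inv_J F) x / inv_Ju F x * (fst (snd w) / D_u F x)) * (D_u F x / snd (snd x))
     else if i = 1 then fst (snd w) / snd (snd x)
     else (snd (snd w) - F x * (fst (snd w) / snd (snd x))) / snd (snd x))"

text \<open>The derivatives of \<open>inv_H F\<close> along the frame, as functions on the
  eight-dimensional space. In the last case \<open>inv_Jpu F\<close> is recovered from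
  \<open>j13\<close> by the commutator identity; in the middle case \<open>K_eq\<close> and
  \<open>L_eq\<close> are solved for the derivatives along the third field. Composed with a chart of
  \<open>\<Sigma>\<close> these become the functions of \<open>H\<close> alone.\<close>

definition frame_value :: "nat \<Rightarrow> R8 \<Rightarrow> point"
  where "frame_value i = (\<lambda>(j, j1, j3, j11, j13, j33, k, l).
    if i = 0 then (j1, j11, j13)
    else if i = 1 then (0, l - j3 - j33, k - (j1 - j3) * (j33 + j3) / j1)
    else (j3, j13 - (1 + j1) * j1, j33))"

lemma coord_\<sigma>: "coord_j_j1_j3 (\<sigma> F x) = inv_H F x"
  by (simp add: coord_j_j1_j3_def \<sigma>_def inv_H_def)

lemma frechet_derivative_triple:
  assumes "smooth_on f S" "smooth_on g S" "smooth_on h S" "x \<in> S"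
  shows "frechet_derivative (\<lambda>x. (f x, g x, h x)) (at x) w
    = (frechet_derivative f (at x) w, frechet_derivative g (at x) w, frechet_derivative h (at x) w)"
proof -
  note d = assms(1-3)[THEN smooth_on_has_derivative, OF assms(4)]
  have "((\<lambda>x. (f x, g x, h x)) has_derivative (\<lambda>w. (frechet_derivative f (at x) w,
      frechet_derivative g (at x) w, frechet_derivative h (at x) w))) (at x)"
    by (intro has_derivative_Pair d)
  from fun_cong[OF frechet_derivative_at[OF this], of w] show ?thesis by (rule sym)
qed

context nondegenerate_system
begin

lemma smooth_H: "smooth_on (inv_H F) S"
  unfolding inv_H_def[abs_def] by (intro smooth_on_Pair S smooth_J smooth_invs)

lemma smooth_\<sigma>: "smooth_on (\<sigma> F) S"
proof -
  have "smooth_on (\<lambda>x. nabla_y F (inv_Jp F) x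
    + (inv_Ju F x - inv_Jp F x) * (inv_Jpp F x + inv_Jp F x) / inv_Ju F x) S"
    by (intro smooth_intros smooth_nabla_y smooth_invs S) (auto simp: Ju_nz)
  then have "smooth_on (inv_K F) S"
    by (rule smooth_on_cong[OF S, THEN iffD2, rotated]) (rule K_eq)
  moreover have "smooth_on (\<lambda>x. nabla_y F (inv_Ju F) x + inv_Jp F x + inv_Jpp F x) S"
    by (intro smooth_intros smooth_nabla_y smooth_invs S)
  then have "smooth_on (inv_L F) S"
    by (rule smooth_on_cong[OF S, THEN iffD2, rotated]) (rule L_eq)
  ultimately show ?thesis
    unfolding \<sigma>_def[abs_def] by (intro smooth_on_Pair S smooth_J smooth_invs)
qed

lemma frechet_derivative_frame:
  assumes "smooth_on h S" "x \<in> S"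
  shows "frechet_derivative h (at x) (frame F i x)
    = (if i = 0 then nabla_u F h x else if i = 1 then nabla_y F h x else nabla_p h x)"
  by (simp add: frechet_derivative_eq_D[OF assms] frame_def nabla_simps nabla_y_def D_t_def)

lemma frechet_derivative_H_frame:
  assumes x: "x \<in> S"
  shows "frechet_derivative (inv_H F) (at x) (frame F i x) = frame_value i (\<sigma> F x)"
  unfolding inv_H_def[abs_def] frechet_derivative_triple[OF smooth_J smooth_invs(1,2) x]
    frechet_derivative_frame[OF smooth_J x] frechet_derivative_frame[OF smooth_invs(1) x]
    frechet_derivative_frame[OF smooth_invs(2) x]
  using Jup_eq[OF x] K_eq[OF x] L_eq[OF x] nabla_y_J[OF x]
  by (simp add: frame_value_def \<sigma>_def inv_defs)

lemma coframe:
  assumes x: "x \<in> S"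
  shows "w = (\<Sum>i\<in>{0, 1, 2}. coframe F i w x *\<^sub>R frame F i x)"
  using p_nz[OF x] Fu_nz[OF x] Ju_nz[OF x]
  by (simp add: coframe_def frame_def prod_eq_iff field_simps)

lemma smooth_coframe: "smooth_on (coframe F i w) S"
  unfolding coframe_def[abs_def]
  by (cases "i = 0"; cases "i = 1"; simp;
      intro smooth_intros smooth_on_D smooth_D_t smooth_J smooth_invs S F;
      simp add: p_nz Fu_nz Ju_nz)

lemma continuous_frame: "continuous_on S (frame F i)"
proof -
  have "smooth_on (frame F i) S"
    unfolding frame_def[abs_def]
    by (cases "i = 0"; cases "i = 1"; simp;
        intro smooth_intros smooth_on_D smooth_D_t smooth_J smooth_invs S F;
        simp add: p_nz Fu_nz Ju_nz)
  then show ?thesis by (rule smooth_on_imp_continuous_on)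
qed

end

section \<open>Charts of the image and the rank of \<open>H\<close>\<close>

lemma regular_nondegenerate: "regular_system F D \<Longrightarrow> nondegenerate_system F D"
  by unfold_locales (auto simp: regular_system_def control_system_def is_domain_def)

text \<open>The form in which condition (3) is used: near each of its points,
  \<open>\<Sigma>\<close> is a graph over an open set of values (j, j1, j3), and
  \<open>\<psi>\<close> restores the missing five coordinates.\<close>

lemma regular_chart:
  assumes reg: "regular_system F D" and s: "s \<in> \<Sigma> F D"
  obtains N \<psi> where "open N" "s \<in> N" "open (coord_j_j1_j3 ` (\<Sigma> F D \<inter> N))"
    "smooth_on \<psi> (coord_j_j1_j3 ` (\<Sigma> F D \<inter> N))"
    "\<And>t. t \<in> \<Sigma> F D \<inter> N \<Longrightarrow> \<psi> (coord_j_j1_j3 t) = t"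
proof -
  have "coordinates_on coord_j_j1_j3 (\<Sigma> F D)" using reg by (simp add: regular_system_def)
  from this[unfolded coordinates_on_def, rule_format, OF s] obtain N where N: "open N" "s \<in> N"
    "inj_on coord_j_j1_j3 (\<Sigma> F D \<inter> N)" "open (coord_j_j1_j3 ` (\<Sigma> F D \<inter> N))"
    "smooth_on (inv_into (\<Sigma> F D \<inter> N) coord_j_j1_j3) (coord_j_j1_j3 ` (\<Sigma> F D \<inter> N))"
    by blast
  show thesis
    by (rule that[OF N(1,2,4,5)]) (rule inv_into_f_f[OF N(3)])
qed

lemma (in nondegenerate_system) open_\<sigma>_preimage:
  assumes "open N"
  shows "open {x \<in> S. \<sigma> F x \<in> N}"
proof -
  have "{x \<in> S. \<sigma> F x \<in> N} = S \<inter> \<sigma> F -` N" by auto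
  then show ?thesis
    using continuous_open_preimage[OF smooth_on_imp_continuous_on[OF smooth_\<sigma>] S assms] by simp
qed

text \<open>Relates the domain of a chart of the image to values of \<open>inv_H F\<close>, so that
  statements about \<open>\<Sigma>\<close> become statements about a map of three-space.\<close>

lemma coord_image_chart:
  "coord_j_j1_j3 ` (\<Sigma> F D \<inter> N) = inv_H F ` {x \<in> D. \<sigma> F x \<in> N}"
proof -
  have "\<Sigma> F D \<inter> N = \<sigma> F ` {x \<in> D. \<sigma> F x \<in> N}" by (auto simp: \<Sigma>_def)
  then show ?thesis by (simp add: image_image coord_\<sigma>)
qed

text \<open>The zero set of the Jacobian is open and closed, and it is not everything by Sard's theorem.\<close>

lemma regular_jacobian_nonzero:
  assumes reg: "regular_system F D" and x: "x \<in> D"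
  shows "jacobian (inv_H F) x \<noteq> 0"
proof -
  interpret nondegenerate_system F D using reg by (rule regular_nondegenerate)
  define Z where "Z = {x \<in> D. jacobian (inv_H F) x = 0}"
  have cont: "continuous_on D (jacobian (inv_H F))"
    by (rule smooth_on_imp_continuous_on[OF smooth_on_jacobian[OF S smooth_H]])
  have "\<exists>r>0. ball a r \<subseteq> Z" if a: "a \<in> Z" for a
  proof -
    have aD: "a \<in> D" "jacobian (inv_H F) a = 0" using a by (auto simp: Z_def)
    then have "\<sigma> F a \<in> \<Sigma> F D" by (simp add: \<Sigma>_def)
    from regular_chart[OF reg this] obtain N \<psi> where N: "open N" "\<sigma> F a \<in> N"
      and T: "open (coord_j_j1_j3 ` (\<Sigma> F D \<inter> N))"
      and \<psi>: "smooth_on \<psi> (coord_j_j1_j3 ` (\<Sigma> F D \<inter> N))"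
        "\<And>t. t \<in> \<Sigma> F D \<inter> N \<Longrightarrow> \<psi> (coord_j_j1_j3 t) = t" by blast
    let ?T = "coord_j_j1_j3 ` (\<Sigma> F D \<inter> N)" and ?S = "{x \<in> D. \<sigma> F x \<in> N}"
    have S': "open ?S" by (rule open_\<sigma>_preimage[OF N(1)])
    have sub: "?S \<subseteq> D" by auto
    have HT: "inv_H F x \<in> ?T" if "x \<in> ?S" for x
      using that by (simp add: coord_image_chart)
    have \<psi>H: "\<psi> (inv_H F x) = \<sigma> F x" if "x \<in> ?S" for x
      using \<psi>(2)[of "\<sigma> F x"] that by (simp add: coord_\<sigma> \<Sigma>_def)
    \<comment> \<open>The middle case of \<open>frame_value\<close> divides by \<open>j1\<close>.
      Every point of the chart comes from a point of \<open>D\<close>, where \<open>inv_Ju F\<close>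
      does not vanish.\<close>
    have nz: "fst (snd (\<psi> z)) \<noteq> 0" if "z \<in> ?T" for z
    proof -
      obtain y where "y \<in> ?S" "z = inv_H F y" using \<open>z \<in> ?T\<close> by (auto simp: coord_image_chart)
      then show ?thesis using \<psi>H[of y] Ju_nz[of y] by (simp add: \<sigma>_def)
    qed
    have n: "smooth_on (\<lambda>z. frame_value i (\<psi> z)) ?T" for i
      unfolding frame_value_def case_prod_unfold
      by (cases "i = 0"; cases "i = 1"; simp; intro smooth_intros T \<psi>(1); simp add: nz)
    obtain r where "r > 0" "ball a r \<subseteq> ?S" "\<And>x. x \<in> ball a r \<Longrightarrow> jacobian (inv_H F) x = 0"
    proof (rule jacobian_zero_spreads[OF S' smooth_on_subset[OF smooth_H sub] _ aD(2) _ T HT n, of "{0, 1, 2}"])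
      show "a \<in> ?S" using aD N by simp
      show "continuous_on ?S (frame F i)" for i by (rule continuous_on_subset[OF continuous_frame sub])
      show "smooth_on (coframe F i w) ?S" for i w by (rule smooth_on_subset[OF smooth_coframe sub])
      show "frechet_derivative (inv_H F) (at x) (frame F i x) = frame_value i (\<psi> (inv_H F x))"
        if "x \<in> ?S" for i x
        using frechet_derivative_H_frame[of x i] \<psi>H[OF that] that by simp
      show "w = (\<Sum>i\<in>{0, 1, 2}. coframe F i w x *\<^sub>R frame F i x)" if "x \<in> ?S" for x w
        using coframe[of x w] that by blast
    qed auto
    then have "ball a r \<subseteq> Z" using sub by (auto simp: Z_def)
    with \<open>r > 0\<close> show ?thesis by blast
  qed
  then have oZ: "open Z" by (simp add: open_contains_ball)
  have oC: "open (D - Z)"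
  proof -
    have "D - Z = D \<inter> jacobian (inv_H F) -` (- {0})" by (auto simp: Z_def)
    then show ?thesis using continuous_open_preimage[OF cont S, of "- {0}"] by (simp add: open_Compl)
  qed
  have "connected D" using reg by (simp add: regular_system_def control_system_def is_domain_def)
  from connectedD[OF this oZ oC] have "Z \<inter> D = {} \<or> (D - Z) \<inter> D = {}" by auto
  moreover have "\<not> D \<subseteq> Z"
  proof
    assume DZ: "D \<subseteq> Z"
    have sx: "\<sigma> F x \<in> \<Sigma> F D" using x by (simp add: \<Sigma>_def)
    \<comment> \<open>The domain of a chart at \<open>\<sigma> F x\<close> is open, contains the
      image of that point, and consists of values of \<open>inv_H F\<close>. It would be an open set
      of critical values.\<close>
    from regular_chart[OF reg this] obtain N where N: "open N" "\<sigma> F x \<in> N"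
      "open (coord_j_j1_j3 ` (\<Sigma> F D \<inter> N))" by blast
    have "coord_j_j1_j3 ` (\<Sigma> F D \<inter> N) = {}"
      by (rule critical_image_has_empty_interior[OF S smooth_H _ N(3)])
         (use DZ in \<open>auto simp: Z_def coord_image_chart\<close>)
    with sx N(2) show False by blast
  qed
  ultimately have "Z = {}" by (auto simp: Z_def)
  then show ?thesis using x unfolding Z_def by blast
qed

section \<open>Invariance under feedback transformations\<close>

locale feedback =
  fixes W :: "(real \<times> real) set" and U :: "real \<times> real \<Rightarrow> real" and Y :: "real \<Rightarrow> real"
  assumes feedback: "feedback_transformation W U Y"
begin

text \<open>\<open>U\<close> and the derivatives of \<open>Y\<close> are regarded as functions of
  all three variables, constant in \<open>p\<close>, so that the calculus of \<open>D_u\<close>,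
  \<open>D_y\<close>, \<open>D_p\<close> applies to them. The prime in \<open>U'\<close> marks this
  extension of \<open>U\<close> and is not a derivative.\<close>

definition cylinder :: "point set" where "cylinder = {(u, y, t). (u, y) \<in> W}"
definition U' :: scalar where "U' = (\<lambda>(u, y, p). U (u, y))"
definition Y0 :: scalar where "Y0 = (\<lambda>(u, y, p). Y y)"
definition Y1 :: scalar where "Y1 = (\<lambda>(u, y, p). deriv Y y)"
definition Y2 :: scalar where "Y2 = (\<lambda>(u, y, p). deriv (deriv Y) y)"

lemma point_action_eq: "point_action U Y x = (U' x, Y0 x, Y1 x * snd (snd x))"
  by (cases x) (simp add: point_action_def U'_def Y0_def Y1_def)

lemma system_action_eq:
  "system_action U Y F x = 1 / Y1 x * F (point_action U Y x) - Y2 x / Y1 x * (snd (snd x))\<^sup>2"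
  by (cases x) (simp add: system_action_def point_action_def Y1_def Y2_def)

lemma diffeo: "diffeo_on (\<lambda>x. (U' x, Y0 x, snd (snd x))) cylinder"
proof -
  have "(\<lambda>x. (U' x, Y0 x, snd (snd x))) = (\<lambda>(u, y, t). (U (u, y), Y y, t))"
    by (auto simp: U'_def Y0_def)
  then show ?thesis using feedback by (simp add: feedback_transformation_def cylinder_def)
qed

lemma open_cylinder: "open cylinder"
  using diffeo by (simp add: diffeo_on_def)

lemma smooth: "smooth_on U' cylinder" "smooth_on Y0 cylinder" "smooth_on Y1 cylinder" "smooth_on Y2 cylinder"
proof -
  have s: "smooth_on (\<lambda>x. (U' x, Y0 x, snd (snd x))) cylinder"
    using diffeo by (simp add: diffeo_on_def)
  show "smooth_on U' cylinder" using smooth_on_fst[OF open_cylinder s] by simp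
  show Y0: "smooth_on Y0 cylinder" using smooth_on_fst[OF open_cylinder smooth_on_snd[OF open_cylinder s]] by simp
  have "Y1 = D_y Y0" by (auto simp: Y1_def Y0_def D_y_def)
  then show Y1: "smooth_on Y1 cylinder" using smooth_on_D(2)[OF open_cylinder Y0] by simp
  have "Y2 = D_y Y1" by (auto simp: Y2_def Y1_def D_y_def)
  then show "smooth_on Y2 cylinder" using smooth_on_D(2)[OF open_cylinder Y1] by simp
qed

lemma D_simps:
  "D_p U' x = 0" "D_u Y0 x = 0" "D_y Y0 x = Y1 x" "D_p Y0 x = 0" "D_u Y1 x = 0" "D_y Y1 x = Y2 x" "D_p Y1 x = 0"
  by (cases x; simp add: U'_def Y0_def Y1_def Y2_def D_u_def D_y_def D_p_def)+

text \<open>The smooth inverse gives the derivative of the transformation a left inverse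
  \<open>g'\<close>, so this derivative kills no nonzero vector. Each claim is tested on a vector
  that would be killed otherwise.\<close>

lemma nonzero:
  assumes x: "x \<in> cylinder"
  shows "D_u U' x \<noteq> 0" "Y1 x \<noteq> 0"
proof -
  let ?f = "\<lambda>x. (U' x, Y0 x, snd (snd x))"
  define g where "g = inv_into cylinder ?f"
  have f: "smooth_on ?f cylinder" "inj_on ?f cylinder" "smooth_on g (?f ` cylinder)"
    using diffeo by (simp_all add: diffeo_on_def g_def)
  have gf: "g (U' z, Y0 z, snd (snd z)) = z" if "z \<in> cylinder" for z
    using inv_into_f_f[OF f(2) that] by (simp only: g_def)
  have df: "(?f has_derivative (\<lambda>w. (fst w * D_u U' x + fst (snd w) * D_y U' x, fst (snd w) * Y1 x, snd (snd w)))) (at x)"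
    using has_derivative_D[OF smooth(1) x] has_derivative_D[OF smooth(2) x]
    by (auto intro!: has_derivative_Pair derivative_eq_intros simp: D_simps fun_eq_iff)
  obtain g' where dg: "(g has_derivative g') (at (?f x))"
    using smooth_on_has_derivative[OF f(3)] x by blast
  have "((\<lambda>z. g (?f z)) has_derivative (\<lambda>w. g' (fst w * D_u U' x + fst (snd w) * D_y U' x, fst (snd w) * Y1 x, snd (snd w)))) (at x)"
    using diff_chain_at[OF df dg] by (simp add: o_def)
  then have dI: "((\<lambda>z. z) has_derivative (\<lambda>w. g' (fst w * D_u U' x + fst (snd w) * D_y U' x, fst (snd w) * Y1 x, snd (snd w)))) (at x)"
    by (rule has_derivative_transform_within_open[OF _ open_cylinder x])
       (simp only: gf)
  have id: "w = g' (fst w * D_u U' x + fst (snd w) * D_y U' x, fst (snd w) * Y1 x, snd (snd w))" for w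
    using fun_cong[OF has_derivative_unique[OF dI has_derivative_ident], of w] by (rule sym)
  have 0: "g' 0 = 0" by (rule linear_0[OF has_derivative_linear[OF dg]])
  show nz: "D_u U' x \<noteq> 0"
    using id[of "(1, 0, 0)"] 0 by (auto simp: zero_prod_def)
  \<comment> \<open>The test vector is tangent to the level set of \<open>U'\<close>: the derivative
    sends it to \<open>(0, D_u U' x * Y1 x, 0)\<close>, and it is nonzero by the first
    claim.\<close>
  show "Y1 x \<noteq> 0"
    using id[of "(- D_y U' x, D_u U' x, 0)"] 0 nz by (auto simp: zero_prod_def)
qed

text \<open>The chain rule for the point action. Derivatives in \<open>u\<close> and
  \<open>p\<close> are merely rescaled, whereas the derivative in \<open>y\<close> mixes all three;
  this is why the invariance of the third field takes a separate argument.\<close>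

lemma D_transport:
  assumes S: "open S" and h: "smooth_on h S" and B: "open B" "B \<subseteq> cylinder" "x \<in> B"
    and x: "point_action U Y x \<in> S" and k: "\<And>z. z \<in> B \<Longrightarrow> k z = h (point_action U Y z)"
  shows "D_u k x = D_u h (point_action U Y x) * D_u U' x"
    "D_y k x = D_u h (point_action U Y x) * D_y U' x + D_y h (point_action U Y x) * Y1 x
      + D_p h (point_action U Y x) * (Y2 x * snd (snd x))"
    "D_p k x = D_p h (point_action U Y x) * Y1 x"
proof -
  let ?\<Phi> = "point_action U Y"
  have xd: "x \<in> cylinder" using B by blast
  have "(?\<Phi> has_derivative (\<lambda>w. (fst w * D_u U' x + fst (snd w) * D_y U' x, fst (snd w) * Y1 x,
      fst (snd w) * Y2 x * snd (snd x) + Y1 x * snd (snd w)))) (at x)"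
    unfolding point_action_eq[abs_def]
    using has_derivative_D[OF smooth(1) xd] has_derivative_D[OF smooth(2) xd] has_derivative_D[OF smooth(3) xd]
    by (auto intro!: has_derivative_Pair derivative_eq_intros simp: D_simps fun_eq_iff)
  from diff_chain_at[OF this has_derivative_D[OF h x]]
  have "((\<lambda>z. h (?\<Phi> z)) has_derivative (\<lambda>w. (fst w * D_u U' x + fst (snd w) * D_y U' x) * D_u h (?\<Phi> x)
      + fst (snd w) * Y1 x * D_y h (?\<Phi> x)
      + (fst (snd w) * Y2 x * snd (snd x) + Y1 x * snd (snd w)) * D_p h (?\<Phi> x))) (at x)"
    by (simp add: o_def)
  then have "(k has_derivative (\<lambda>w. (fst w * D_u U' x + fst (snd w) * D_y U' x) * D_u h (?\<Phi> x)
      + fst (snd w) * Y1 x * D_y h (?\<Phi> x)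
      + (fst (snd w) * Y2 x * snd (snd x) + Y1 x * snd (snd w)) * D_p h (?\<Phi> x))) (at x)"
    by (rule has_derivative_transform_within_open[OF _ B(1,3)]) (simp add: k)
  from D_has_derivative[OF this]
  show "D_u k x = D_u h (?\<Phi> x) * D_u U' x"
    "D_y k x = D_u h (?\<Phi> x) * D_y U' x + D_y h (?\<Phi> x) * Y1 x + D_p h (?\<Phi> x) * (Y2 x * snd (snd x))"
    "D_p k x = D_p h (?\<Phi> x) * Y1 x"
    by simp_all
qed

end

section \<open>Invariance of the derivations and of \<open>\<sigma>\<close>\<close>

locale related_systems = feedback W U Y + F: nondegenerate_system F S + G: nondegenerate_system G R
  for W U Y F S G R +
  fixes B :: "point set"
  assumes B: "open B" "B \<subseteq> cylinder" "B \<subseteq> R"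
    and action: "\<And>x. x \<in> B \<Longrightarrow> point_action U Y x \<in> S"
    and G_eq: "\<And>x. x \<in> B \<Longrightarrow> G x = system_action U Y F x"
begin

abbreviation "\<Phi> \<equiv> point_action U Y"

lemma p_\<Phi>: "snd (snd (\<Phi> x)) = Y1 x * snd (snd x)"
  by (simp add: point_action_eq)

lemma in_cylinder: "x \<in> B \<Longrightarrow> x \<in> cylinder" and in_R: "x \<in> B \<Longrightarrow> x \<in> R"
  using B by auto

lemma G_values:
  assumes x: "x \<in> B"
  shows "G x = F (\<Phi> x) / Y1 x - Y2 x / Y1 x * (snd (snd x))\<^sup>2"
    "D_u G x = D_u F (\<Phi> x) * D_u U' x / Y1 x"
    "D_p G x = D_p F (\<Phi> x) - 2 * Y2 x / Y1 x * snd (snd x)"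
proof -
  let ?p = "snd (snd x)" and ?k = "\<lambda>x. F (\<Phi> x)"
  show "G x = F (\<Phi> x) / Y1 x - Y2 x / Y1 x * ?p\<^sup>2"
    by (simp add: G_eq[OF x] system_action_eq)
  note Y1 = nonzero(2)[OF in_cylinder[OF x]]
  have k: "smooth_on ?k B"
  proof (rule smooth_on_compose[OF B(1) F.S action F.F])
    show "smooth_on \<Phi> B"
      unfolding point_action_eq[abs_def]
      by (intro smooth_intros B smooth_on_subset[OF smooth(1) B(2)] smooth_on_subset[OF smooth(2) B(2)]
          smooth_on_subset[OF smooth(3) B(2)])
  qed
  have Dk: "D_u ?k x = D_u F (\<Phi> x) * D_u U' x" "D_p ?k x = D_p F (\<Phi> x) * Y1 x"
    by (rule D_transport[OF F.S F.F B(1,2) x action[OF x] refl])+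
  have DY2: "D_u Y2 x = 0" "D_p Y2 x = 0"
    by (cases x; simp add: Y2_def D_u_def D_p_def)+
  note d = has_derivative_D[OF k x] has_derivative_D[OF smooth(3) in_cylinder[OF x]] has_derivative_D[OF smooth(4) in_cylinder[OF x]]
  have "((\<lambda>x. F (\<Phi> x) / Y1 x - Y2 x / Y1 x * (snd (snd x))\<^sup>2) has_derivative
    (\<lambda>w. (fst w * D_u ?k x + fst (snd w) * D_y ?k x + snd (snd w) * D_p ?k x) / Y1 x
       - ?k x * (fst (snd w) * Y2 x) / (Y1 x)\<^sup>2
       - (((fst w * D_u Y2 x + fst (snd w) * D_y Y2 x + snd (snd w) * D_p Y2 x) / Y1 x
            - Y2 x * (fst (snd w) * Y2 x) / (Y1 x)\<^sup>2) * ?p\<^sup>2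
         + Y2 x / Y1 x * (2 * ?p * snd (snd w))))) (at x)"
    using Y1 by (auto intro!: derivative_eq_intros d simp: D_simps fun_eq_iff field_simps power2_eq_square)
  then have dG: "(G has_derivative
    (\<lambda>w. (fst w * D_u ?k x + fst (snd w) * D_y ?k x + snd (snd w) * D_p ?k x) / Y1 x
       - ?k x * (fst (snd w) * Y2 x) / (Y1 x)\<^sup>2
       - (((fst w * D_u Y2 x + fst (snd w) * D_y Y2 x + snd (snd w) * D_p Y2 x) / Y1 x
            - Y2 x * (fst (snd w) * Y2 x) / (Y1 x)\<^sup>2) * ?p\<^sup>2
         + Y2 x / Y1 x * (2 * ?p * snd (snd w))))) (at x)"
    by (rule has_derivative_transform_within_open[OF _ B(1) x]) (simp add: G_eq system_action_eq)
  show "D_u G x = D_u F (\<Phi> x) * D_u U' x / Y1 x"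
    "D_p G x = D_p F (\<Phi> x) - 2 * Y2 x / Y1 x * ?p"
    using D_has_derivative(1,3)[OF dG] Y1 by (simp_all add: DY2 Dk)
qed

text \<open>p J = (p d/dp - 2) F. The operator commutes with the scaling of \<open>p\<close> and
  annihilates the inhomogeneous term of the action, which is quadratic in \<open>p\<close>. The
  factor \<open>1 / Y1\<close> left over is absorbed by the division by \<open>p\<close>.\<close>

lemma J_invariant:
  assumes x: "x \<in> B"
  shows "inv_J G x = inv_J F (\<Phi> x)"
  using nonzero(2)[OF in_cylinder[OF x]] G.p_nz[OF in_R[OF x]]
  by (simp add: F.J_eq[OF action[OF x]] G.J_eq[OF in_R[OF x]] G_values[OF x] p_\<Phi> field_simps power2_eq_square)

text \<open>The factor \<open>D_u U'\<close> in the derivative of \<open>k\<close> cancels against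
  the same factor in \<open>D_u G\<close>, and the factor \<open>Y1\<close> in the derivatives
  against the scaling of \<open>p\<close>.\<close>

lemma nabla_invariant:
  assumes h: "smooth_on h S" and k: "\<And>z. z \<in> B \<Longrightarrow> k z = h (\<Phi> z)" and x: "x \<in> B"
  shows "nabla_u G k x = nabla_u F h (\<Phi> x)" "nabla_p k x = nabla_p h (\<Phi> x)"
proof -
  note D = D_transport[OF F.S h B(1,2) x action[OF x] k]
  show "nabla_u G k x = nabla_u F h (\<Phi> x)" "nabla_p k x = nabla_p h (\<Phi> x)"
    using nonzero[OF in_cylinder[OF x]] F.Fu_nz[OF action[OF x]]
    by (simp_all add: nabla_simps D G_values[OF x] p_\<Phi> field_simps)
qed

text \<open>A control held fixed for \<open>G\<close> is not fixed for \<open>F\<close>, because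
  \<open>U\<close> depends on the moving state \<open>y\<close>. The defect is the resulting
  velocity of the new control times \<open>D_u h\<close>.\<close>

lemma D_t_transport:
  assumes h: "smooth_on h S" and k: "\<And>z. z \<in> B \<Longrightarrow> k z = h (\<Phi> z)" and x: "x \<in> B"
  shows "D_t G k x = D_t F h (\<Phi> x) + snd (snd x) * D_y U' x * D_u h (\<Phi> x)"
proof -
  note D = D_transport[OF F.S h B(1,2) x action[OF x] k]
  show ?thesis
    using nonzero[OF in_cylinder[OF x]]
    by (simp add: D_t_def D G_values[OF x] p_\<Phi> field_simps power2_eq_square)
qed

lemma J_invariants:
  assumes x: "x \<in> B"
  shows "inv_Ju G x = inv_Ju F (\<Phi> x)" "inv_Jp G x = inv_Jp F (\<Phi> x)"
  unfolding inv_Ju_def inv_Jp_def by (intro nabla_invariant F.smooth_J J_invariant x; assumption)+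

text \<open>The defect of \<open>D_t\<close> is \<open>nabla_u F h\<close> times a factor that is
  the same for every \<open>h\<close>. Applied to \<open>inv_J F\<close>, it shifts the quotient in
  \<open>nabla_y\<close> by exactly this factor, and the two shifts cancel.\<close>

lemma nabla_y_invariant:
  assumes h: "smooth_on h S" and k: "\<And>z. z \<in> B \<Longrightarrow> k z = h (\<Phi> z)" and x: "x \<in> B"
  shows "nabla_y G k x = nabla_y F h (\<Phi> x)"
proof -
  have p: "snd (snd (\<Phi> x)) \<noteq> 0" by (rule F.p_nz[OF action[OF x]])
  have Ju: "D_u (inv_J F) (\<Phi> x) = inv_Ju F (\<Phi> x) * D_u F (\<Phi> x) / snd (snd (\<Phi> x))"
    and hu: "D_u h (\<Phi> x) = nabla_u F h (\<Phi> x) * D_u F (\<Phi> x) / snd (snd (\<Phi> x))"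
    using p F.Fu_nz[OF action[OF x]] by (simp_all add: inv_Ju_def nabla_simps(1))
  have t: "D_t G k x = D_t F h (\<Phi> x) + snd (snd x) * D_y U' x * D_u h (\<Phi> x)"
    "D_t G (inv_J G) x = D_t F (inv_J F) (\<Phi> x) + snd (snd x) * D_y U' x * D_u (inv_J F) (\<Phi> x)"
    by (rule D_t_transport; fact h k x F.smooth_J J_invariant)+
  have u: "nabla_u G k x = nabla_u F h (\<Phi> x)"
    by (rule nabla_invariant(1); fact h k x)
  show ?thesis
    unfolding nabla_y_def t J_invariants(1)[OF x] u Ju hu
    using p F.Ju_nz[OF action[OF x]] F.Fu_nz[OF action[OF x]] by (simp add: field_simps)
qed

lemma \<sigma>_invariant:
  assumes x: "x \<in> B"
  shows "\<sigma> G x = \<sigma> F (\<Phi> x)"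
proof -
  have "nabla_u G (inv_Ju G) x = nabla_u F (inv_Ju F) (\<Phi> x)"
    "nabla_u G (inv_Jp G) x = nabla_u F (inv_Jp F) (\<Phi> x)" "nabla_p (inv_Jp G) x = nabla_p (inv_Jp F) (\<Phi> x)"
    by (rule nabla_invariant; fact F.smooth_invs J_invariants x)+
  then have second: "inv_Juu G x = inv_Juu F (\<Phi> x)" "inv_Jup G x = inv_Jup F (\<Phi> x)"
    "inv_Jpp G x = inv_Jpp F (\<Phi> x)"
    by (simp_all add: inv_defs)
  have "nabla_y G (inv_Ju G) x = nabla_y F (inv_Ju F) (\<Phi> x)"
    "nabla_y G (inv_Jp G) x = nabla_y F (inv_Jp F) (\<Phi> x)"
    by (rule nabla_y_invariant; fact F.smooth_invs J_invariants x)+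
  with second show ?thesis
    by (simp add: \<sigma>_def J_invariant[OF x] J_invariants[OF x] F.K_eq[OF action[OF x]] G.K_eq[OF in_R[OF x]]
        F.L_eq[OF action[OF x]] G.L_eq[OF in_R[OF x]])
qed

end

lemma feedback_related_\<sigma>:
  assumes "nondegenerate_system F S" "nondegenerate_system G R" "feedback_related F A G B"
    "open B" "A \<subseteq> S" "B \<subseteq> R"
  shows "\<sigma> F ` A = \<sigma> G ` B"
proof -
  from assms(3) obtain W U Y where t: "feedback_transformation W U Y" "B \<subseteq> {(u, y, p). (u, y) \<in> W}"
    "point_action U Y ` B = A" "\<forall>x\<in>B. system_action U Y F x = G x"
    unfolding feedback_related_def by blast
  interpret feedback W U Y by unfold_locales (rule t(1))
  interpret F: nondegenerate_system F S by (rule assms(1))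
  interpret G: nondegenerate_system G R by (rule assms(2))
  interpret related_systems W U Y F S G R B
    by unfold_locales (use assms t in \<open>auto simp: cylinder_def\<close>)
  have "\<sigma> G ` B = (\<lambda>x. \<sigma> F (point_action U Y x)) ` B"
    by (intro image_cong refl \<sigma>_invariant)
  also have "\<dots> = \<sigma> F ` A" using t(3) by (auto simp: image_image[symmetric])
  finally show ?thesis by simp
qed

section \<open>Construction of the equivalence\<close>

lemma has_field_derivative_D:
  assumes "smooth_on h S" "(u, y, p) \<in> S"
  shows "((\<lambda>s. h (s, y, p)) has_field_derivative D_u h (u, y, p)) (at u)"
    "((\<lambda>s. h (u, s, p)) has_field_derivative D_y h (u, y, p)) (at y)"
    "((\<lambda>s. h (u, y, s)) has_field_derivative D_p h (u, y, p)) (at p)"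
proof -
  note d = has_derivative_D[OF assms]
  have c: "((\<lambda>s. (s, y, p)) has_derivative (\<lambda>s. (s, 0, 0))) (at u)"
    "((\<lambda>s. (u, s, p)) has_derivative (\<lambda>s. (0, s, 0))) (at y)"
    "((\<lambda>s. (u, y, s)) has_derivative (\<lambda>s. (0, 0, s))) (at p)"
    by (auto intro!: has_derivative_Pair derivative_eq_intros simp: zero_prod_def)
  show "((\<lambda>s. h (s, y, p)) has_field_derivative D_u h (u, y, p)) (at u)"
    using diff_chain_at[OF c(1) d] by (simp add: o_def has_field_derivative_def mult_commute_abs)
  show "((\<lambda>s. h (u, s, p)) has_field_derivative D_y h (u, y, p)) (at y)"
    using diff_chain_at[OF c(2) d] by (simp add: o_def has_field_derivative_def mult_commute_abs)
  show "((\<lambda>s. h (u, y, s)) has_field_derivative D_p h (u, y, p)) (at p)"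
    using diff_chain_at[OF c(3) d] by (simp add: o_def has_field_derivative_def mult_commute_abs)
qed

lemma D_cong_open:
  assumes "open B" "x \<in> B" "\<And>z. z \<in> B \<Longrightarrow> h z = k z" "smooth_on k B"
  shows "D_u h x = D_u k x" "D_y h x = D_y k x" "D_p h x = D_p k x"
proof -
  have "(h has_derivative (\<lambda>w. fst w * D_u k x + fst (snd w) * D_y k x + snd (snd w) * D_p k x)) (at x)"
    by (rule has_derivative_transform_within_open[OF has_derivative_D[OF assms(4,2)] assms(1,2)]) (simp add: assms(3))
  from D_has_derivative[OF this]
  show "D_u h x = D_u k x" "D_y h x = D_y k x" "D_p h x = D_p k x" by simp_all
qed

text \<open>Boxes are needed because their coordinate slices are intervals, on which a vanishing
  partial derivative integrates to constancy.\<close>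

lemma open_box_around:
  fixes b :: point
  assumes "open S" "b \<in> S"
  obtains e where "e > 0"
    "{fst b - e<..<fst b + e} \<times> {fst (snd b) - e<..<fst (snd b) + e} \<times> {snd (snd b) - e<..<snd (snd b) + e} \<subseteq> S"
proof -
  obtain r where r: "r > 0" "ball b r \<subseteq> S" using openE[OF assms] by blast
  \<comment> \<open>The norm is at most the sum of the three coordinate distances, hence the third
    of the radius.\<close>
  have "x \<in> ball b r" if x: "\<bar>fst x - fst b\<bar> < r / 3" "\<bar>fst (snd x) - fst (snd b)\<bar> < r / 3"
    "\<bar>snd (snd x) - snd (snd b)\<bar> < r / 3" for x
  proof -
    have "norm (x - b) \<le> norm (fst (x - b)) + norm (snd (x - b))"
      using norm_Pair_le[of "fst (x - b)" "snd (x - b)"] by (simp only: prod.collapse)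
    also have "norm (snd (x - b)) \<le> norm (fst (snd (x - b))) + norm (snd (snd (x - b)))"
      using norm_Pair_le[of "fst (snd (x - b))" "snd (snd (x - b))"] by (simp only: prod.collapse)
    finally have "norm (x - b) < r" using x by simp
    then show ?thesis by (simp add: dist_norm norm_minus_commute)
  qed
  note in_ball = this
  have "{fst b - r/3<..<fst b + r/3} \<times> {fst (snd b) - r/3<..<fst (snd b) + r/3}
      \<times> {snd (snd b) - r/3<..<snd (snd b) + r/3} \<subseteq> ball b r"
  proof
    fix x assume "x \<in> {fst b - r/3<..<fst b + r/3} \<times> {fst (snd b) - r/3<..<fst (snd b) + r/3}
      \<times> {snd (snd b) - r/3<..<snd (snd b) + r/3}"
    then show "x \<in> ball b r"
      by (intro in_ball; cases x; simp only: mem_Times_iff greaterThanLessThan_iff fst_conv snd_conv; arith)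
  qed
  with r show thesis by (intro that[of "r/3"]) auto
qed

section \<open>Frame-preserving maps are feedback transformations\<close>

text \<open>Preserving the first and last fields makes the second component of \<open>\<Phi>\<close>
  a function of \<open>y\<close>, the first a function of (u, y), and the third independent of
  \<open>u\<close>. The y-component of the equation for the middle field says that the third
  component is \<open>Y'\<close> times \<open>p\<close>, and its p-component is the transformation
  law of systems.\<close>

lemma frame_map_feedback_related:
  assumes F: "nondegenerate_system F S" and G: "nondegenerate_system G R"
    and B: "B = I1 \<times> I2 \<times> I3" "I1 = {l1<..<r1}" "I2 = {l2<..<r2}" "I3 = {l3<..<r3}" "b \<in> B" "B \<subseteq> R"
    and \<Phi>: "smooth_on \<Phi> B" "inj_on \<Phi> B" "\<And>z. z \<in> B \<Longrightarrow> \<Phi> z \<in> S"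
    and frame: "\<And>i z. z \<in> B \<Longrightarrow> frechet_derivative \<Phi> (at z) (frame G i z) = frame F i (\<Phi> z)"
  shows "feedback_related F (\<Phi> ` B) G B"
proof -
  interpret F: nondegenerate_system F S by (rule F)
  interpret G: nondegenerate_system G R by (rule G)
  obtain u0 y0 p0 where b: "b = (u0, y0, p0)" by (cases b)
  have b0: "u0 \<in> I1" "y0 \<in> I2" "p0 \<in> I3" using B(1,5) b by auto
  have oB: "open B" unfolding B by (intro open_Times) auto
  define \<Phi>1 where "\<Phi>1 z = fst (\<Phi> z)" for z
  define \<Phi>2 where "\<Phi>2 z = fst (snd (\<Phi> z))" for z
  define \<Phi>3 where "\<Phi>3 z = snd (snd (\<Phi> z))" for z
  have sm: "smooth_on \<Phi>1 B" "smooth_on \<Phi>2 B" "smooth_on \<Phi>3 B"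
    unfolding \<Phi>1_def \<Phi>2_def \<Phi>3_def by (intro smooth_on_fst smooth_on_snd oB \<Phi>)+
  have \<Phi>_eq: "\<Phi> = (\<lambda>z. (\<Phi>1 z, \<Phi>2 z, \<Phi>3 z))" by (simp add: \<Phi>1_def \<Phi>2_def \<Phi>3_def fun_eq_iff)
  have p: "snd (snd z) \<noteq> 0" "\<Phi>3 z \<noteq> 0" "D_u G z \<noteq> 0" "D_u F (\<Phi> z) \<noteq> 0" if "z \<in> B" for z
    using that B(6) G.p_nz[of z] G.Fu_nz[of z] F.p_nz[OF \<Phi>(3)[OF that]] F.Fu_nz[OF \<Phi>(3)[OF that]]
    by (auto simp: \<Phi>3_def)
  have fr: "frechet_derivative \<Phi>1 (at z) (frame G i z) = fst (frame F i (\<Phi> z))"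
    "frechet_derivative \<Phi>2 (at z) (frame G i z) = fst (snd (frame F i (\<Phi> z)))"
    "frechet_derivative \<Phi>3 (at z) (frame G i z) = snd (snd (frame F i (\<Phi> z)))" if z: "z \<in> B" for i z
    using frame[OF z, of i] unfolding \<Phi>_eq frechet_derivative_triple[OF sm z] by (simp_all add: prod_eq_iff)
  \<comment> \<open>The formula for derivatives along the frame of \<open>G\<close>, for functions
    smooth only on \<open>B\<close>, such as the components of \<open>\<Phi>\<close>.\<close>
  have fr': "\<And>i. frechet_derivative h (at z) (frame G i z)
      = (if i = 0 then nabla_u G h z else if i = 1 then nabla_y G h z else nabla_p h z)"
    if "smooth_on h B" "z \<in> B" for h z
    by (simp add: frechet_derivative_eq_D[OF that] frame_def nabla_simps nabla_y_def D_t_def)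
  \<comment> \<open>The frame equations by components: index 0 gives the first three, index 2 the
    next three, and the y- and p-components of index 1 the last two.\<close>
  have n: "snd (snd z) / D_u G z * D_u \<Phi>1 z = \<Phi>3 z / D_u F (\<Phi> z)" "D_u \<Phi>2 z = 0" "D_u \<Phi>3 z = 0"
    "D_p \<Phi>1 z = 0" "D_p \<Phi>2 z = 0" "snd (snd z) * D_p \<Phi>3 z = \<Phi>3 z"
    "snd (snd z) * D_y \<Phi>2 z = \<Phi>3 z" "snd (snd z) * D_y \<Phi>3 z + G z * D_p \<Phi>3 z = F (\<Phi> z)"
    if z: "z \<in> B" for z
  proof -
    note q = p[OF z]
    note 0 = fr(1)[OF z, of 0] fr(2)[OF z, of 0] fr(3)[OF z, of 0]
    note 2 = fr(1)[OF z, of 2] fr(2)[OF z, of 2] fr(3)[OF z, of 2]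
    note 1 = fr(2)[OF z, of 1] fr(3)[OF z, of 1]
    show 01: "snd (snd z) / D_u G z * D_u \<Phi>1 z = \<Phi>3 z / D_u F (\<Phi> z)" "D_u \<Phi>2 z = 0" "D_u \<Phi>3 z = 0"
      using 0 q unfolding fr'[OF sm(1) z] fr'[OF sm(2) z] fr'[OF sm(3) z]
      by (simp_all add: nabla_simps frame_def \<Phi>3_def)
    show 02: "D_p \<Phi>1 z = 0" "D_p \<Phi>2 z = 0" "snd (snd z) * D_p \<Phi>3 z = \<Phi>3 z"
      using 2 q unfolding fr'[OF sm(1) z] fr'[OF sm(2) z] fr'[OF sm(3) z]
      by (simp_all add: nabla_simps frame_def \<Phi>3_def)
    show "snd (snd z) * D_y \<Phi>2 z = \<Phi>3 z" "snd (snd z) * D_y \<Phi>3 z + G z * D_p \<Phi>3 z = F (\<Phi> z)"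
      using 1 unfolding fr'[OF sm(2) z] fr'[OF sm(3) z]
      by (simp_all add: nabla_y_def D_t_def nabla_simps frame_def 01 02 \<Phi>3_def)
  qed
  have const: "f s = f t" if "\<And>s. s \<in> {l<..<r} \<Longrightarrow> (f has_field_derivative 0) (at s)"
    "s \<in> {l<..<r}" "t \<in> {l<..<r}" for f :: "real \<Rightarrow> real" and l r s t
  proof -
    have "\<exists>c. \<forall>s\<in>{l<..<r}. f s = c"
      by (rule has_field_derivative_zero_constant) (auto intro!: has_field_derivative_at_within[OF that(1)] simp del: greaterThanLessThan_iff)
    then show ?thesis using that(2,3) by metis
  qed
  \<comment> \<open>The components are sampled on the slice through the centre \<open>b\<close>. By
    the constancy facts below, other slices of the box give the same functions.\<close>
  define U where "U = (\<lambda>(u, y). \<Phi>1 (u, y, p0))"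
  define Y where "Y y = \<Phi>2 (u0, y, p0)" for y
  have inB: "(u, y, p) \<in> B \<longleftrightarrow> u \<in> I1 \<and> y \<in> I2 \<and> p \<in> I3" for u y p by (simp add: B(1))
  have \<Phi>2_p: "\<Phi>2 (u, y, p) = \<Phi>2 (u, y, p0)" and \<Phi>1_p: "\<Phi>1 (u, y, p) = \<Phi>1 (u, y, p0)"
    if "(u, y, p) \<in> B" for u y p
  proof -
    have "((\<lambda>s. \<Phi>2 (u, y, s)) has_field_derivative 0) (at s)" "((\<lambda>s. \<Phi>1 (u, y, s)) has_field_derivative 0) (at s)"
      if "s \<in> {l3<..<r3}" for s
    proof -
      have B': "(u, y, s) \<in> B" using that \<open>(u, y, p) \<in> B\<close> B(4) by (simp add: inB)
      show "((\<lambda>s. \<Phi>2 (u, y, s)) has_field_derivative 0) (at s)" "((\<lambda>s. \<Phi>1 (u, y, s)) has_field_derivative 0) (at s)"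
        using has_field_derivative_D(3)[OF sm(2) B'] has_field_derivative_D(3)[OF sm(1) B']
        by (simp_all only: n(4,5)[OF B'])
    qed
    note d = this
    have "p \<in> {l3<..<r3}" "p0 \<in> {l3<..<r3}" using that b0 B(4) by (simp_all add: inB)
    from const[OF d(1) this] const[OF d(2) this]
    show "\<Phi>2 (u, y, p) = \<Phi>2 (u, y, p0)" "\<Phi>1 (u, y, p) = \<Phi>1 (u, y, p0)"
      by simp_all
  qed
  have \<Phi>2_u: "\<Phi>2 (u, y, p0) = \<Phi>2 (u0, y, p0)" if "(u, y, p) \<in> B" for u y p
  proof -
    have "((\<lambda>s. \<Phi>2 (s, y, p0)) has_field_derivative 0) (at s)" if "s \<in> {l1<..<r1}" for s
    proof -
      have B': "(s, y, p0) \<in> B" using that \<open>(u, y, p) \<in> B\<close> B(2) b0 by (simp add: inB)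
      show ?thesis
        using has_field_derivative_D(1)[OF sm(2) B'] by (simp only: n(2)[OF B'])
    qed
    note d = this
    have "u \<in> {l1<..<r1}" "u0 \<in> {l1<..<r1}" using that b0 B(2) by (simp_all add: inB)
    from const[OF d this] show ?thesis by simp
  qed
  have \<Phi>12: "\<Phi>1 z = (\<lambda>(u, y, p). U (u, y)) z" "\<Phi>2 z = (\<lambda>(u, y, p). Y y) z" if "z \<in> B" for z
    using that \<Phi>1_p[of "fst z" "fst (snd z)" "snd (snd z)"] \<Phi>2_p[of "fst z" "fst (snd z)" "snd (snd z)"]
      \<Phi>2_u[of "fst z" "fst (snd z)" "snd (snd z)"]
    by (auto simp: U_def Y_def split: prod.splits)
  \<comment> \<open>A feedback transformation is a diffeomorphism for all real \<open>t\<close>,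
    whereas \<open>p\<close> is confined to \<open>I3\<close> in the box. So the candidate
    \<open>f\<close> on the unbounded set \<open>E\<close> is built from the slice at
    \<open>p0\<close>, with \<open>t\<close> carried along unchanged.\<close>
  define W where "W = I1 \<times> I2"
  define E where "E = {(u, y, t :: real). (u, y) \<in> W}"
  define f where "f = (\<lambda>(u, y, t :: real). (U (u, y), Y y, t))"
  define f1 where "f1 = (\<lambda>z :: point. \<Phi>1 (fst z, fst (snd z), p0))"
  define f2 where "f2 = (\<lambda>z :: point. \<Phi>2 (u0, fst (snd z), p0))"
  have f_eq: "f = (\<lambda>z. (f1 z, f2 z, snd (snd z)))"
    by (auto simp: f_def f1_def f2_def U_def Y_def)
  have E_eq: "E = I1 \<times> I2 \<times> UNIV" by (auto simp: E_def W_def)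
  have oE: "open E" unfolding E_eq B by (intro open_Times) auto
  have f1: "smooth_on f1 E" unfolding f1_def
    by (rule smooth_on_compose[OF oE oB _ sm(1)]) (auto simp: E_eq inB b0 intro!: smooth_intros oE[unfolded E_eq])
  have f2: "smooth_on f2 E" unfolding f2_def
    by (rule smooth_on_compose[OF oE oB _ sm(2)]) (auto simp: E_eq inB b0 intro!: smooth_intros oE[unfolded E_eq])
  have f: "smooth_on f E" unfolding f_eq by (intro smooth_intros oE f1 f2)
  have Df: "D_u f1 (u, y, t) = D_u \<Phi>1 (u, y, p0)" "D_y f2 (u, y, t) = D_y \<Phi>2 (u0, y, p0)"
    "D_u f2 (u, y, t) = 0" "D_p f1 (u, y, t) = 0" "D_p f2 (u, y, t) = 0" for u y t
    by (simp_all add: f1_def f2_def D_u_def D_y_def D_p_def)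
  have nz: "D_u \<Phi>1 z \<noteq> 0" "D_y \<Phi>2 z \<noteq> 0" if "z \<in> B" for z
    using n(1,7)[OF that] p[OF that] by auto
  \<comment> \<open>The matrix is triangular, with diagonal entries the derivative of
    \<open>f1\<close> in \<open>u\<close>, the derivative of \<open>f2\<close> in \<open>y\<close>,
    and 1.\<close>
  have jac: "jacobian f z \<noteq> 0" if z: "z \<in> E" for z
  proof -
    obtain u y t where zz: "z = (u, y, t)" by (cases z)
    have uy: "(u, y, p0) \<in> B" "(u0, y, p0) \<in> B" using z b0 by (auto simp: zz E_eq inB)
    have "D_u f1 z \<noteq> 0" "D_y f2 z \<noteq> 0" "D_u f2 z = 0"
      using nz uy by (simp_all add: zz Df)
    then show ?thesis
      unfolding f_eq jacobian_def Let_def frechet_derivative_triple[OF f1 f2 smooth_on_snd[OF oE smooth_on_snd[OF oE smooth_on_ident]] z]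
        frechet_derivative_eq_D[OF f1 z] frechet_derivative_eq_D[OF f2 z]
        frechet_derivative_eq_D[OF smooth_on_snd[OF oE smooth_on_snd[OF oE smooth_on_ident]] z]
      by (simp add: det3_def zz D_u_def[of "\<lambda>x. snd (snd x)"] D_y_def[of "\<lambda>x. snd (snd x)"] D_p_def[of "\<lambda>x. snd (snd x)"])
  qed
  have dY: "(Y has_field_derivative D_y \<Phi>2 (u0, y, p0)) (at y)" if "y \<in> I2" for y
    unfolding Y_def[abs_def] by (rule has_field_derivative_D(2)[OF sm(2)]) (use that b0 in \<open>simp add: inB\<close>)
  have Y_ne: "Y y \<noteq> Y y'" if "y \<in> I2" "y' \<in> I2" and lt: "y < y'" for y y'
  proof -
    have I: "c \<in> I2" if "y \<le> c" "c \<le> y'" for c using that \<open>y \<in> I2\<close> \<open>y' \<in> I2\<close> B(3) by auto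
    obtain c where c: "y < c" "c < y'" "Y y' - Y y = (y' - y) * D_y \<Phi>2 (u0, c, p0)"
      using MVT2[OF lt, of Y "\<lambda>c. D_y \<Phi>2 (u0, c, p0)"] dY I by blast
    moreover have "D_y \<Phi>2 (u0, c, p0) \<noteq> 0" using nz(2) I[of c] c b0 by (simp add: inB)
    ultimately show ?thesis using lt by auto
  qed
  have injf: "inj_on f E"
  proof (rule inj_onI)
    fix z z' assume zz: "z \<in> E" "z' \<in> E" "f z = f z'"
    obtain u y t where z: "z = (u, y, t)" by (cases z)
    obtain u' y' t' where z': "z' = (u', y', t')" by (cases z')
    have eq: "\<Phi>1 (u, y, p0) = \<Phi>1 (u', y', p0)" "Y y = Y y'" "t = t'"
      using zz(3) by (simp_all add: z z' f_def U_def)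
    have I: "u \<in> I1" "u' \<in> I1" "y \<in> I2" "y' \<in> I2" using zz by (auto simp: z z' E_eq)
    have y: "y = y'" using Y_ne[of y y'] Y_ne[of y' y] I eq(2) by (metis linorder_neqE)
    have inB2: "(u, y, p0) \<in> B" "(u', y, p0) \<in> B" using I b0 y by (auto simp: inB)
    \<comment> \<open>Injectivity of \<open>U\<close> in \<open>u\<close> is inherited from
      \<open>\<Phi>\<close>: at equal \<open>y\<close> and \<open>p0\<close> the second and third
      components agree for all \<open>u\<close>, so equal first components force equal values of
      \<open>\<Phi>\<close>.\<close>
    have "\<Phi>3 (u, y, p0) = \<Phi>3 (u', y, p0)"
    proof -
      have "((\<lambda>s. \<Phi>3 (s, y, p0)) has_field_derivative 0) (at s)" if "s \<in> {l1<..<r1}" for s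
      proof -
        have B': "(s, y, p0) \<in> B" using that I B(2) b0 by (simp add: inB)
        show ?thesis
          using has_field_derivative_D(1)[OF sm(3) B'] by (simp only: n(3)[OF B'])
      qed
      from const[OF this I(1,2)[unfolded B(2)]] show ?thesis by simp
    qed
    then have "\<Phi> (u, y, p0) = \<Phi> (u', y, p0)"
      using eq y \<Phi>12(2)[OF inB2(1)] \<Phi>12(2)[OF inB2(2)] by (simp add: \<Phi>_eq)
    then have "u = u'" using inj_onD[OF \<Phi>(2) _ inB2] by blast
    then show "z = z'" using y eq by (simp add: z z')
  qed
  have ft: "feedback_transformation W U Y"
    using diffeo_on_jacobian[OF oE f injf jac] by (simp add: feedback_transformation_def f_def E_def)
  interpret feedback W U Y by unfold_locales (rule ft)
  have Bd: "B \<subseteq> cylinder" unfolding cylinder_def by (auto simp: W_def B(1))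
  have \<Phi>12': "\<And>z. z \<in> B \<Longrightarrow> \<Phi>1 z = U' z" "\<And>z. z \<in> B \<Longrightarrow> \<Phi>2 z = Y0 z"
    using \<Phi>12 by (simp_all add: U'_def Y0_def)
  note smB = smooth_on_subset[OF smooth(1) Bd] smooth_on_subset[OF smooth(2) Bd] smooth_on_subset[OF smooth(3) Bd]
  have \<Phi>3: "\<Phi>3 z = Y1 z * snd (snd z)" if z: "z \<in> B" for z
    using n(7)[OF z] D_cong_open(2)[OF oB z \<Phi>12'(2) smB(2)] by (simp add: D_simps mult.commute)
  have act: "point_action U Y z = \<Phi> z" if z: "z \<in> B" for z
    by (simp add: \<Phi>_eq point_action_eq \<Phi>12'[OF z] \<Phi>3[OF z])
  have "system_action U Y F z = G z" if z: "z \<in> B" for z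
  proof -
    have "smooth_on (\<lambda>z. Y1 z * snd (snd z)) B" by (intro smooth_intros oB smB)
    note c = D_cong_open[OF oB z \<Phi>3 this]
    have zd: "z \<in> cylinder" using Bd z by blast
    have "((\<lambda>z. Y1 z * snd (snd z)) has_derivative
        (\<lambda>w. fst (snd w) * Y2 z * snd (snd z) + Y1 z * snd (snd w))) (at z)"
      by (auto intro!: derivative_eq_intros has_derivative_D[OF smooth(3) zd] simp: D_simps fun_eq_iff)
    from D_has_derivative[OF this]
    have "D_y \<Phi>3 z = Y2 z * snd (snd z)" "D_p \<Phi>3 z = Y1 z"
      using c by simp_all
    \<comment> \<open>The p-component of the middle frame equation, with the third component of
      \<open>\<Phi>\<close> now known to be \<open>Y1\<close> times \<open>p\<close>; divided by
      \<open>Y1\<close> it is the action on systems.\<close>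
    then have "F (\<Phi> z) = Y2 z * (snd (snd z))\<^sup>2 + G z * Y1 z"
      using n(8)[OF z] by (simp add: power2_eq_square algebra_simps)
    then show ?thesis
      using nonzero(2)[OF zd] by (simp add: system_action_eq act[OF z] field_simps)
  qed
  moreover have "point_action U Y ` B = \<Phi> ` B" using act by (rule image_cong[OF refl])
  moreover have "B \<subseteq> {(u, y, p). (u, y) \<in> W}" using Bd by (simp add: cylinder_def)
  ultimately show ?thesis using ft unfolding feedback_related_def by blast
qed

section \<open>Equivalence near two points with equal invariants\<close>

lemma local_equivalence:
  assumes F: "regular_system F DF" and G: "regular_system G DG" and \<Sigma>: "\<Sigma> F DF = \<Sigma> G DG"
    and a: "a \<in> DF" and b: "b \<in> DG" and ab: "\<sigma> F a = \<sigma> G b"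
  shows "\<exists>A B. is_domain A \<and> is_domain B \<and> A \<subseteq> DF \<and> B \<subseteq> DG \<and> a \<in> A \<and> b \<in> B \<and> feedback_related F A G B"
proof -
  interpret F: nondegenerate_system F DF by (rule regular_nondegenerate[OF F])
  interpret G: nondegenerate_system G DG by (rule regular_nondegenerate[OF G])
  have sF: "\<sigma> F a \<in> \<Sigma> F DF" using a by (simp add: \<Sigma>_def)
  obtain N \<psi> where N: "open N" "\<sigma> F a \<in> N"
    and "open (coord_j_j1_j3 ` (\<Sigma> F DF \<inter> N))" "smooth_on \<psi> (coord_j_j1_j3 ` (\<Sigma> F DF \<inter> N))"
    and \<psi>: "\<And>t. t \<in> \<Sigma> F DF \<inter> N \<Longrightarrow> \<psi> (coord_j_j1_j3 t) = t"
    by (rule regular_chart[OF F sF]) blast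
  \<comment> \<open>Equality of the images enters here: values of both systems lie on one surface,
    so the single chart \<open>\<psi>\<close>, taken from \<open>F\<close>, recovers all eight
    invariants of either system from the first three.\<close>
  have \<sigma>_eq: "\<sigma> F x = \<sigma> G z"
    if "x \<in> DF" "\<sigma> F x \<in> N" "z \<in> DG" "\<sigma> G z \<in> N" "inv_H F x = inv_H G z" for x z
  proof -
    have "\<sigma> F x \<in> \<Sigma> F DF" "\<sigma> G z \<in> \<Sigma> G DG" using that by (simp_all add: \<Sigma>_def)
    then have "\<sigma> F x \<in> \<Sigma> F DF \<inter> N" "\<sigma> G z \<in> \<Sigma> F DF \<inter> N" using that \<Sigma> by blast+
    from \<psi>[OF this(1)] \<psi>[OF this(2)] that(5) show ?thesis by (simp add: coord_\<sigma>)
  qed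
  let ?S = "{x \<in> DF. \<sigma> F x \<in> N}" and ?R = "{x \<in> DG. \<sigma> G x \<in> N}"
  have S: "open ?S" and R: "open ?R" by (rule F.open_\<sigma>_preimage G.open_\<sigma>_preimage N)+
  have HF: "smooth_on (inv_H F) ?S" by (rule smooth_on_subset[OF F.smooth_H]) auto
  have HG: "smooth_on (inv_H G) DG" by (rule G.smooth_H)
  have aS: "a \<in> ?S" using a N by simp
  obtain r where r: "r > 0" "ball a r \<subseteq> ?S" "diffeo_on (inv_H F) (ball a r)"
    "\<And>x. x \<in> ball a r \<Longrightarrow> jacobian (inv_H F) x \<noteq> 0"
    by (rule local_diffeo_jacobian[OF S HF aS regular_jacobian_nonzero[OF F a]]) blast
  let ?V = "inv_H F ` ball a r"
  define g where "g = inv_into (ball a r) (inv_H F)"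
  have V: "open ?V" "smooth_on g ?V" and injF: "inj_on (inv_H F) (ball a r)"
    using r(3) by (simp_all add: diffeo_on_def g_def)
  have g: "g v \<in> ball a r" "inv_H F (g v) = v" if "v \<in> ?V" for v
    using inv_into_into[OF that] f_inv_into_f[OF that] by (simp_all only: g_def)
  have "inv_H F a = inv_H G b" using ab by (simp add: \<sigma>_def inv_H_def)
  then have bV: "inv_H G b \<in> ?V" and gb: "g (inv_H G b) = a"
    using r(1) inv_into_f_f[OF injF, of a] by (auto simp: g_def intro!: image_eqI[of _ _ a])
  \<comment> \<open>The points where \<open>\<Phi>\<close> can be formed, since
    \<open>inv_H G\<close> takes values in the domain of the local inverse \<open>g\<close>, and
    where the invariants stay inside the chart, so that \<open>\<sigma>_eq\<close> applies.\<close>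
  define R' where "R' = ?R \<inter> inv_H G -` ?V"
  have R': "open R'"
    unfolding R'_def
    by (rule continuous_open_preimage[OF _ R V(1)])
       (rule continuous_on_subset[OF smooth_on_imp_continuous_on[OF HG]], auto)
  have bR': "b \<in> R'" using b ab N(2) bV by (simp add: R'_def)
  have R'_sub: "R' \<subseteq> DG" by (auto simp: R'_def)
  obtain r' where r': "r' > 0" "ball b r' \<subseteq> R'" "diffeo_on (inv_H G) (ball b r')"
    by (rule local_diffeo_jacobian[OF R' smooth_on_subset[OF HG R'_sub] bR' regular_jacobian_nonzero[OF G b]])
  have bb: "b \<in> ball b r'" using r' by simp
  obtain e where e: "e > 0"
    "{fst b - e<..<fst b + e} \<times> {fst (snd b) - e<..<fst (snd b) + e} \<times> {snd (snd b) - e<..<snd (snd b) + e} \<subseteq> ball b r'"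
    by (rule open_box_around[OF open_ball bb])
  define I where "I c = {c - e<..<c + e}" for c
  define B where "B = I (fst b) \<times> I (fst (snd b)) \<times> I (snd (snd b))"
  have Bb: "B \<subseteq> ball b r'" using e(2) by (simp add: B_def I_def)
  have BR': "B \<subseteq> R'" and BDG: "B \<subseteq> DG" using Bb r'(2) R'_sub by auto
  have bB: "b \<in> B" using e(1) by (cases b) (simp add: B_def I_def)
  have oB: "open B" unfolding B_def I_def by (intro open_Times) auto
  have cB: "connected B" unfolding B_def I_def by (intro connected_Times) auto
  define \<Phi> where "\<Phi> z = g (inv_H G z)" for z
  have HV: "inv_H G z \<in> ?V" if "z \<in> B" for z using that BR' by (auto simp: R'_def)
  have \<Phi>_ball: "\<Phi> z \<in> ball a r" and H\<Phi>: "inv_H F (\<Phi> z) = inv_H G z" if "z \<in> B" for z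
    using g[OF HV[OF that]] by (simp_all only: \<Phi>_def)
  have \<Phi>_S: "\<Phi> z \<in> ?S" if "z \<in> B" for z using \<Phi>_ball[OF that] r(2) by blast
  have HGB: "smooth_on (inv_H G) B" by (rule smooth_on_subset[OF HG BDG])
  have sm: "smooth_on \<Phi> B"
    unfolding \<Phi>_def by (rule smooth_on_compose[OF oB V(1) HV V(2) HGB])
  have inj: "inj_on \<Phi> B"
  proof (rule inj_onI)
    fix z z' assume z: "z \<in> B" "z' \<in> B" "\<Phi> z = \<Phi> z'"
    have "inj_on (inv_H G) (ball b r')" using r'(3) by (simp add: diffeo_on_def)
    moreover have "inv_H G z = inv_H G z'" using H\<Phi>[OF z(1)] H\<Phi>[OF z(2)] z(3) by simp
    ultimately show "z = z'" using z Bb by (meson inj_onD subsetD)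
  qed
  have fr: "frechet_derivative \<Phi> (at z) (frame G i z) = frame F i (\<Phi> z)" if z: "z \<in> B" for i z
  proof -
    have zG: "z \<in> DG" "\<sigma> G z \<in> N" using z BR' by (auto simp: R'_def)
    have zF: "\<Phi> z \<in> DF" "\<sigma> F (\<Phi> z) \<in> N" using \<Phi>_S[OF z] by auto
    have s: "\<sigma> F (\<Phi> z) = \<sigma> G z" by (rule \<sigma>_eq[OF zF zG H\<Phi>[OF z]])
    note dF = smooth_on_has_derivative[OF F.smooth_H zF(1)]
    have "((\<lambda>z. inv_H F (\<Phi> z)) has_derivative
        (\<lambda>w. frechet_derivative (inv_H F) (at (\<Phi> z)) (frechet_derivative \<Phi> (at z) w))) (at z)"
      using diff_chain_at[OF smooth_on_has_derivative[OF sm z] dF] by (simp add: o_def)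
    then have "(inv_H G has_derivative
        (\<lambda>w. frechet_derivative (inv_H F) (at (\<Phi> z)) (frechet_derivative \<Phi> (at z) w))) (at z)"
      by (rule has_derivative_transform_within_open[OF _ oB z]) (rule H\<Phi>)
    \<comment> \<open>The identity \<open>inv_H F (\<Phi> z) = inv_H G z\<close> is differentiated
      along the frame of \<open>G\<close>. The right side is \<open>frame_value i\<close> at the
      common value of \<open>\<sigma>\<close>, which is also the derivative of
      \<open>inv_H F\<close> along the frame of \<open>F\<close>. Invertibility of that derivative
      then identifies the two vectors.\<close>
    from fun_cong[OF frechet_derivative_at[OF this], of "frame G i z"]
    have "frechet_derivative (inv_H F) (at (\<Phi> z)) (frechet_derivative \<Phi> (at z) (frame G i z))
        = frechet_derivative (inv_H F) (at (\<Phi> z)) (frame F i (\<Phi> z))"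
      by (simp only: G.frechet_derivative_H_frame[OF zG(1)] F.frechet_derivative_H_frame[OF zF(1)] s)
    then show ?thesis
      by (rule linear_injective3[OF has_derivative_linear[OF dF], rotated])
         (use regular_jacobian_nonzero[OF F zF(1)] in \<open>simp add: jacobian_def Let_def\<close>)
  qed
  have "feedback_related F (\<Phi> ` B) G B"
    by (rule frame_map_feedback_related[OF F.nondegenerate_system_axioms G.nondegenerate_system_axioms
          B_def I_def I_def I_def bB BDG sm inj _ fr]) (use \<Phi>_S in auto)
  moreover have "is_domain B" using oB cB bB by (auto simp: is_domain_def)
  moreover have "is_domain (\<Phi> ` B)"
    unfolding is_domain_def
    using invariance_of_domain[OF smooth_on_imp_continuous_on[OF sm] oB inj]
      connected_continuous_image[OF smooth_on_imp_continuous_on[OF sm] cB] bB by blast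
  moreover have "\<Phi> ` B \<subseteq> DF" using \<Phi>_S by auto
  moreover have "a \<in> \<Phi> ` B" using bB gb by (intro image_eqI[of _ _ b]) (simp_all add: \<Phi>_def)
  ultimately show ?thesis using BDG bB by blast
qed

theorem theorem3:
  fixes F G :: "real \<times> real \<times> real \<Rightarrow> real"
    and D_F D_G :: "(real \<times> real \<times> real) set"
  assumes "regular_system F D_F"
    and "regular_system G D_G"
  shows "locally_feedback_equivalent F D_F G D_G \<longleftrightarrow> \<Sigma> F D_F = \<Sigma> G D_G"
proof
  assume eq: "locally_feedback_equivalent F D_F G D_G"
  \<comment> \<open>Invariance applies to each related pair of pieces; since such pieces surround
    every point of either domain, both inclusions follow.\<close>
  have *: "\<sigma> F ` A = \<sigma> G ` B"
    if "is_domain B" "A \<subseteq> D_F" "B \<subseteq> D_G" "feedback_related F A G B" for A B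
    using feedback_related_\<sigma>[OF regular_nondegenerate[OF assms(1)] regular_nondegenerate[OF assms(2)] that(4) _ that(2,3)]
      that(1) by (simp add: is_domain_def)
  show "\<Sigma> F D_F = \<Sigma> G D_G"
  proof (rule equalityI; rule subsetI)
    fix s assume "s \<in> \<Sigma> F D_F"
    then obtain a where a: "a \<in> D_F" "s = \<sigma> F a" by (auto simp: \<Sigma>_def)
    with eq obtain A B where AB: "is_domain B" "A \<subseteq> D_F" "B \<subseteq> D_G" "a \<in> A" "feedback_related F A G B"
      unfolding locally_feedback_equivalent_def by blast
    then have "s \<in> \<sigma> G ` B" using * a by blast
    then show "s \<in> \<Sigma> G D_G" using AB(3) by (auto simp: \<Sigma>_def)
  next
    fix s assume "s \<in> \<Sigma> G D_G"
    then obtain b where b: "b \<in> D_G" "s = \<sigma> G b" by (auto simp: \<Sigma>_def)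
    with eq obtain A B where AB: "is_domain B" "A \<subseteq> D_F" "B \<subseteq> D_G" "b \<in> B" "feedback_related F A G B"
      unfolding locally_feedback_equivalent_def by blast
    then have "s \<in> \<sigma> F ` A" using * b by blast
    then show "s \<in> \<Sigma> F D_F" using AB(2) by (auto simp: \<Sigma>_def)
  qed
next
  assume \<Sigma>: "\<Sigma> F D_F = \<Sigma> G D_G"
  note loc = local_equivalence[OF assms \<Sigma>]
  show "locally_feedback_equivalent F D_F G D_G"
    unfolding locally_feedback_equivalent_def
  proof (intro conjI ballI)
    fix a assume a: "a \<in> D_F"
    then have "\<sigma> F a \<in> \<Sigma> G D_G" unfolding \<Sigma>[symmetric] by (simp add: \<Sigma>_def)
    then obtain b where "b \<in> D_G" "\<sigma> F a = \<sigma> G b" by (auto simp: \<Sigma>_def)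
    with loc[OF a] show "\<exists>A B. is_domain A \<and> is_domain B \<and> A \<subseteq> D_F \<and> B \<subseteq> D_G \<and> a \<in> A \<and> feedback_related F A G B"
      by blast
  next
    fix b assume b: "b \<in> D_G"
    then have "\<sigma> G b \<in> \<Sigma> F D_F" unfolding \<Sigma> by (simp add: \<Sigma>_def)
    then obtain a where "a \<in> D_F" "\<sigma> F a = \<sigma> G b" by (auto simp: \<Sigma>_def)
    with loc[OF _ b] show "\<exists>A B. is_domain A \<and> is_domain B \<and> A \<subseteq> D_F \<and> B \<subseteq> D_G \<and> b \<in> B \<and> feedback_related F A G B"
      by blast
  qed
qed

end
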